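(* Let $K$ be a field, let $E$ be a row-finite graph and let $H\subseteq E^0$ be saturated and hereditary. If the ideal $I(H)$ of $L_K(E)$ is regular, then the map $f:P_c(E)\setminus H\to P_c(E/H)$, $f(v)=v$, is bijective.
   Context: A graph $E=(E^0,E^1,r,s)$ consists of a countable set of vertices $E^0$, a countable set of edges $E^1$, and range and source maps $r,s:E^1\to E^0$. It is row-finite if $s^{-1}(v)$ is finite for each vertex $v$. A nontrivial path is $\alpha=e_1\cdots e_n$ with $r(e_i)=s(e_{i+1})$ for $1\le i\le n-1$; $s(\alpha)=s(e_1)$, $r(\alpha)=r(e_n)$. Vertices are paths of length $0$ (with $s(v)=r(v)=v$). $E^*$ is the set of all finite paths. $E^0_{reg}$ is the set of vertices $v$ with $s^{-1}(v)$ nonempty and finite. A path $\alpha=e_1\cdots e_n$ is a cycle if $r(e_n)=s(e_1)$ and $s(e_i)\ne s(e_j)$ for all $i\ne j$. An exit for $\alpha$ is an edge $e$ such that $s(e)=s(e_i)$ for some $i$ but $e\ne e_i$. A set $H\subseteq E^0$ is hereditary if $\alpha\in E^*$ and $s(\alpha)\in H$ imply $r(\alpha)\in H$; it is saturated if for all $v\in E^0_{reg}$, $r(s^{-1}(v))\subseteq H$ implies $v\in H$. The quotient graph $E/H$ of $E$ by a hereditary set $H$ has $(E/H)^0=E^0\setminus H$, $(E/H)^1=\{e\in E^1: r(e)\notin H\}$, with range and source maps restricted from $E$. $P_c(E)$ denotes the set of all vertices of $E$ lying in cycles without exit in $E$ (and similarly $P_c(E/H)$ for the graph $E/H$). For $H$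 hereditary and saturated, $v\mapsto v$ gives a well-defined map $f:P_c(E)\setminus H\to P_c(E/H)$. The Leavitt path algebra $L_K(E)$ is the universal $K$-algebra generated by pairwise orthogonal idempotents $\{v:v\in E^0\}$ and elements $\{e,e^*:e\in E^1\}$ subject to: (1) $s(e)e=er(e)=e$ for all $e\in E^1$; (2) $r(e)e^*=e^*s(e)=e^*$ for all $e\in E^1$; (3) $e^*f=\delta_{e,f}\,r(e)$ for all $e,f\in E^1$; (4) $v=\sum_{e\in E^1,\,s(e)=v}ee^*$ for all $v\in E^0_{reg}$. For a path $\alpha=e_1\cdots e_n$, $\alpha^*=e_n^*\cdots e_1^*$, and $v^*=v$ for vertices. For hereditary $H$, $I(H)$ denotes the ideal of $L_K(E)$ generated by $H$, that is, $I(H)=\operatorname{span}\{\gamma\lambda^*:\gamma,\lambda\in E^*,\ r(\gamma)=r(\lambda)\in H\}$. For a subset $X$ of an algebra $A$, $X^\perp=\{a\in A: ax=xa=0\text{ for all }x\in X\}$. A (two-sided) ideal $J\subseteq A$ is called regular if $J=J^{\perp\perp}$. *)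

theory Defs
  imports
    "Graph_Theory.Arc_Walk"
    "HOL-Library.Poly_Mapping"
    "HOL-Library.Countable_Set"
    "HOL-Library.Multiset"
begin

section \<open>Graphs\<close>

text \<open>
  A graph \<open>E\<close> with source and range maps is a \<^locale>\<open>wf_digraph\<close>, with
  \<open>tail E\<close> as source and \<open>head E\<close> as range map; loops and parallel edges are allowed. The
  finite paths from \<open>u\<close> to \<open>v\<close> are the arc walks \<open>pre_digraph.awalk E u p v\<close>; the
  empty walk at \<open>u \<in> verts E\<close> is the vertex \<open>u\<close> seen as a path of length 0.
\<close>

definition row_finite :: "('v, 'e) pre_digraph \<Rightarrow> bool" where
  "row_finite E \<longleftrightarrow> (\<forall>v \<in> verts E. finite (out_arcs E v))"

definition regular_verts :: "('v, 'e) pre_digraph \<Rightarrow> 'v set" where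
  "regular_verts E = {v \<in> verts E. out_arcs E v \<noteq> {} \<and> finite (out_arcs E v)}"

definition hereditary :: "('v, 'e) pre_digraph \<Rightarrow> 'v set \<Rightarrow> bool" where
  "hereditary E H \<longleftrightarrow> H \<subseteq> verts E \<and>
     (\<forall>u p v. pre_digraph.awalk E u p v \<longrightarrow> u \<in> H \<longrightarrow> v \<in> H)"

definition saturated :: "('v, 'e) pre_digraph \<Rightarrow> 'v set \<Rightarrow> bool" where
  "saturated E H \<longleftrightarrow> H \<subseteq> verts E \<and>
     (\<forall>v \<in> regular_verts E. head E ` out_arcs E v \<subseteq> H \<longrightarrow> v \<in> H)"

definition quotient_graph :: "('v, 'e) pre_digraph \<Rightarrow> 'v set \<Rightarrow> ('v, 'e) pre_digraph" where
  "quotient_graph E H =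
     \<lparr>verts = verts E - H, arcs = {e \<in> arcs E. head E e \<notin> H}, tail = tail E, head = head E\<rparr>"

text \<open>
  \<^const>\<open>pre_digraph.cycle\<close> asks for the ranges of the edges to be pairwise distinct. For a closed
  path this is the same as asking it for the sources:
\<close>

lemma cycle_iff_distinct_tails:
  "pre_digraph.cycle E p \<longleftrightarrow>
     p \<noteq> [] \<and> (\<exists>u. pre_digraph.awalk E u p u) \<and> distinct (map (tail E) p)"
proof -
  have heads: "tl (pre_digraph.awalk_verts E u p) = map (head E) p"
    if "pre_digraph.cas E u p w" for u w
    using that
  proof (induction p arbitrary: u)
    case (Cons e p)
    then show ?case
      by (cases p) (auto simp: pre_digraph.awalk_verts.simps pre_digraph.cas.simps)
  qed (simp add: pre_digraph.awalk_verts.simps)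
  have shift: "map (tail E) p @ [w] = u # map (head E) p"
    if "pre_digraph.cas E u p w" for u w
    using that
    by (induction p arbitrary: u) (auto simp: pre_digraph.cas.simps)
  have "distinct (map (tail E) p) \<longleftrightarrow> distinct (map (head E) p)"
    if "pre_digraph.cas E u p u" for u
  proof -
    have "mset (map (tail E) p) = mset (map (head E) p)"
      using arg_cong[OF shift[OF that], of mset] by (simp del: mset_map map_append)
    then show ?thesis
      by (rule mset_eq_imp_distinct_iff)
  qed
  with heads show ?thesis
    unfolding pre_digraph.cycle_def pre_digraph.awalk_def by metis
qed

definition is_exit :: "('v, 'e) pre_digraph \<Rightarrow> 'e list \<Rightarrow> 'e \<Rightarrow> bool" where
  "is_exit E p e \<longleftrightarrow> e \<in> arcs E \<and> (\<exists>i < length p. tail E e = tail E (p ! i) \<and> e \<noteq> p ! i)"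

definition P_c :: "('v, 'e) pre_digraph \<Rightarrow> 'v set" where
  "P_c E = {v. \<exists>p. pre_digraph.cycle E p \<and> (\<nexists>e. is_exit E p e) \<and> v \<in> tail E ` set p}"

section \<open>Algebras without unit\<close>

text \<open>
  \<open>L\<^sub>K(E)\<close> has no unit if \<open>E\<close> has infinitely many vertices, so the rings of
  the HOL-Algebra library do not apply.
\<close>

record ('k, 'a) k_algebra =
  alg_carrier :: "'a set"
  alg_add :: "'a \<Rightarrow> 'a \<Rightarrow> 'a"
  alg_zero :: 'a
  alg_mult :: "'a \<Rightarrow> 'a \<Rightarrow> 'a"
  alg_scale :: "'k \<Rightarrow> 'a \<Rightarrow> 'a"

definition two_sided_ideal :: "('k, 'a) k_algebra \<Rightarrow> 'a set \<Rightarrow> bool" where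
  "two_sided_ideal A J \<longleftrightarrow> J \<subseteq> alg_carrier A \<and> alg_zero A \<in> J \<and>
     (\<forall>x \<in> J. \<forall>y \<in> J. alg_add A x y \<in> J) \<and>
     (\<forall>k. \<forall>x \<in> J. alg_scale A k x \<in> J) \<and>
     (\<forall>a \<in> alg_carrier A. \<forall>x \<in> J. alg_mult A a x \<in> J \<and> alg_mult A x a \<in> J)"

definition generated_ideal :: "('k, 'a) k_algebra \<Rightarrow> 'a set \<Rightarrow> 'a set" where
  "generated_ideal A X = \<Inter> {J. two_sided_ideal A J \<and> X \<subseteq> J}"

definition perp :: "('k, 'a) k_algebra \<Rightarrow> 'a set \<Rightarrow> 'a set" where
  "perp A X = {a \<in> alg_carrier A. \<forall>x \<in> X. alg_mult A a x = alg_zero A \<and> alg_mult A x a = alg_zero A}"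

definition regular_ideal :: "('k, 'a) k_algebra \<Rightarrow> 'a set \<Rightarrow> bool" where
  "regular_ideal A J \<longleftrightarrow> two_sided_ideal A J \<and> J = perp A (perp A J)"

definition ideal_coset :: "('k, 'a) k_algebra \<Rightarrow> 'a set \<Rightarrow> 'a \<Rightarrow> 'a set" where
  "ideal_coset A J a = alg_add A a ` J"

text \<open>
  The unions below are unions of a single coset when \<open>J\<close> is an ideal.
\<close>

definition quotient_algebra ::
    "('k, 'a) k_algebra \<Rightarrow> 'a set \<Rightarrow> ('k, 'a set) k_algebra" where
  "quotient_algebra A J =
     \<lparr>alg_carrier = ideal_coset A J ` alg_carrier A,
      alg_add = (\<lambda>X Y. \<Union>x \<in> X. \<Union>y \<in> Y. ideal_coset A J (alg_add A x y)),
      alg_zero = ideal_coset A J (alg_zero A),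
      alg_mult = (\<lambda>X Y. \<Union>x \<in> X. \<Union>y \<in> Y. ideal_coset A J (alg_mult A x y)),
      alg_scale = (\<lambda>k X. \<Union>x \<in> X. ideal_coset A J (alg_scale A k x))\<rparr>"

section \<open>The free algebra\<close>

text \<open>
  Lists under concatenation, wrapped so that finitely supported functions on them multiply by
  convolution, which is multiplication of noncommutative polynomials.
\<close>

datatype 'g word = Word (letters: "'g list")

instantiation word :: (type) monoid_add
begin

definition zero_word :: "'a word" where
  "0 = Word []"

definition plus_word :: "'a word \<Rightarrow> 'a word \<Rightarrow> 'a word" where
  "u + w = Word (letters u @ letters w)"

instance
  by standard (simp_all add: zero_word_def plus_word_def)

end

text \<open>
  The free nonunital algebra on \<open>S\<close>: the noncommutative polynomials in the variables
  \<open>S\<close> without constant term.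
\<close>

definition free_algebra :: "'g set \<Rightarrow> ('k::field, 'g word \<Rightarrow>\<^sub>0 'k) k_algebra" where
  "free_algebra S =
     \<lparr>alg_carrier = {p. \<forall>w \<in> Poly_Mapping.keys p. letters w \<noteq> [] \<and> set (letters w) \<subseteq> S},
      alg_add = (+),
      alg_zero = 0,
      alg_mult = (*),
      alg_scale = (\<lambda>k. Poly_Mapping.map ((*) k))\<rparr>"

definition var :: "'g \<Rightarrow> 'g word \<Rightarrow>\<^sub>0 'k::field" where
  "var g = Poly_Mapping.single (Word [g]) 1"

section \<open>Leavitt path algebras\<close>

datatype ('v, 'e) generator = Vertex 'v | Edge 'e | Ghost 'e

definition generators :: "('v, 'e) pre_digraph \<Rightarrow> ('v, 'e) generator set" where
  "generators E = Vertex ` verts E \<union> Edge ` arcs E \<union> Ghost ` arcs E"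

text \<open>A relation \<open>a = b\<close> is encoded as the element \<open>a - b\<close>.\<close>

definition relators ::
    "('v, 'e) pre_digraph \<Rightarrow> (('v, 'e) generator word \<Rightarrow>\<^sub>0 'k::field) set" where
  "relators E =
     {var (Vertex v) * var (Vertex v) - var (Vertex v) | v. v \<in> verts E} \<union>
     {var (Vertex v) * var (Vertex w) | v w. v \<in> verts E \<and> w \<in> verts E \<and> v \<noteq> w} \<union>
     {var (Vertex (tail E e)) * var (Edge e) - var (Edge e) | e. e \<in> arcs E} \<union>
     {var (Edge e) * var (Vertex (head E e)) - var (Edge e) | e. e \<in> arcs E} \<union>
     {var (Vertex (head E e)) * var (Ghost e) - var (Ghost e) | e. e \<in> arcs E} \<union>
     {var (Ghost e) * var (Vertex (tail E e)) - var (Ghost e) | e. e \<in> arcs E} \<union>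
     {var (Ghost e) * var (Edge e) - var (Vertex (head E e)) | e. e \<in> arcs E} \<union>
     {var (Ghost e) * var (Edge f) | e f. e \<in> arcs E \<and> f \<in> arcs E \<and> e \<noteq> f} \<union>
     {var (Vertex v) - (\<Sum>e \<in> out_arcs E v. var (Edge e) * var (Ghost e)) | v. v \<in> regular_verts E}"

definition relation_ideal ::
    "('v, 'e) pre_digraph \<Rightarrow> (('v, 'e) generator word \<Rightarrow>\<^sub>0 'k::field) set" where
  "relation_ideal E = generated_ideal (free_algebra (generators E)) (relators E)"

type_synonym ('k, 'v, 'e) lpa_elem = "(('v, 'e) generator word \<Rightarrow>\<^sub>0 'k) set"

definition leavitt_path_algebra ::
    "('v, 'e) pre_digraph \<Rightarrow> ('k::field, ('k, 'v, 'e) lpa_elem) k_algebra" where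
  "leavitt_path_algebra E = quotient_algebra (free_algebra (generators E)) (relation_ideal E)"

definition lpa_vertex :: "('v, 'e) pre_digraph \<Rightarrow> 'v \<Rightarrow> ('k::field, 'v, 'e) lpa_elem" where
  "lpa_vertex E v = ideal_coset (free_algebra (generators E)) (relation_ideal E) (var (Vertex v))"

definition vertex_ideal :: "('v, 'e) pre_digraph \<Rightarrow> 'v set \<Rightarrow> ('k::field, 'v, 'e) lpa_elem set" where
  "vertex_ideal E H = generated_ideal (leavitt_path_algebra E) (lpa_vertex E ` H)"

end

theory Submission
  imports Defs "HOL-Library.Sublist"
begin

text \<open>
  The only issue is that a cycle of \<open>E/H\<close> without exit in \<open>E/H\<close> might have an exit in \<open>E\<close>, which
  then leads into \<open>H\<close>. In that case, for a vertex \<open>v\<close> of the cycle and \<open>a \<in> I(H)\<^sup>\<bottom>\<close>, one gets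
  \<open>v a = p p\<^sup>* a\<close> for every path \<open>p\<close> that starts at \<open>v\<close> and winds around the cycle, because the exits
  contribute elements of \<open>I(H) a = 0\<close>. Once \<open>p\<close> is long enough, \<open>p\<^sup>* a\<close> is a linear combination of
  ghost paths, and such a combination annihilated by \<open>I(H)\<close> must vanish. Hence \<open>v a = 0\<close>, by the
  involution also \<open>a v = 0\<close>, and so \<open>v \<in> I(H)\<^sup>\<bottom>\<^sup>\<bottom> = I(H)\<close>. A representation of \<open>L(E)\<close> in which
  exactly the vertices in \<open>H\<close> act as zero then gives \<open>v \<in> H\<close>, which is absurd.
\<close>

section \<open>Ideals and quotients of the free algebra\<close>

lemma poly_mapping_sum_single:
  "p = (\<Sum>w \<in> Poly_Mapping.keys p. Poly_Mapping.single w (Poly_Mapping.lookup p w))"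
proof (rule poly_mapping_eqI)
  fix x
  show "Poly_Mapping.lookup p x =
    Poly_Mapping.lookup (\<Sum>w \<in> Poly_Mapping.keys p. Poly_Mapping.single w (Poly_Mapping.lookup p w)) x"
    by (cases "x \<in> Poly_Mapping.keys p")
       (auto simp: lookup_sum lookup_single when_def in_keys_iff sum.delta)
qed

text \<open>A finitely supported function is a finite sum of monomials, so a property closed under
  addition only has to be checked on monomials. The multiplicativity of \<open>ev\<close> and the
  rules for \<open>star\<close> reduce to words in this way.\<close>

lemma poly_mapping_add_induct [case_names zero single add]:
  fixes p :: "'a \<Rightarrow>\<^sub>0 'b::comm_monoid_add"
  assumes "P 0" and "\<And>w k. P (Poly_Mapping.single w k)"
    and "\<And>p q. P p \<Longrightarrow> P q \<Longrightarrow> P (p + q)"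
  shows "P p"
proof -
  have "P (\<Sum>w \<in> A. Poly_Mapping.single w (Poly_Mapping.lookup p w))" if "finite A" for A
    using that by (induction rule: finite_induct) (auto intro: assms)
  then show ?thesis
    by (subst poly_mapping_sum_single[of p]) simp
qed

text \<open>Scaling becomes multiplication by a constant polynomial, so the ring rules apply to it,
  although nonzero constants lie outside the carrier of the free nonunital algebra.\<close>

definition const :: "'k::field \<Rightarrow> 'g word \<Rightarrow>\<^sub>0 'k" where
  "const k = Poly_Mapping.single 0 k"

lemma const_0 [simp]: "const 0 = 0" and const_1 [simp]: "const 1 = 1"
  by (simp_all add: const_def)

lemma const_minus_1: "const (- 1) = - 1"
  by (simp add: const_def single_uminus)

lemma const_sum: "const (sum f A) = (\<Sum>x \<in> A. const (f x))"
  by (induction A rule: infinite_finite_induct) (auto simp: const_def single_add)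

lemma const_commute: "p * const k = const k * p"
proof (induction p rule: poly_mapping_add_induct)
  case (single w l)
  then show ?case
    by (simp add: const_def mult_single mult.commute)
qed (simp_all add: algebra_simps)

lemma const_left_commute: "p * (const k * q) = const k * (p * q)"
  using const_commute[of p k] by (simp add: mult.assoc[symmetric])

section \<open>The carrier of the free algebra and its ideals\<close>

definition free_carrier :: "'g set \<Rightarrow> ('g word \<Rightarrow>\<^sub>0 'k::field) set" where
  "free_carrier S = {p. \<forall>w \<in> Poly_Mapping.keys p. letters w \<noteq> [] \<and> set (letters w) \<subseteq> S}"

lemma free_algebra_simps [simp]:
  "alg_carrier (free_algebra S) = free_carrier S"
  "alg_add (free_algebra S) = (+)"
  "alg_zero (free_algebra S) = 0"
  "alg_mult (free_algebra S) = (*)"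
  "alg_scale (free_algebra S) k p = const k * p"
  by (simp_all add: free_algebra_def free_carrier_def const_def mult_map_scale_conv_mult)

lemma letters_plus: "letters (u + w) = letters u @ letters w"
  by (simp add: plus_word_def)

lemma letters_zero: "letters 0 = []"
  by (simp add: zero_word_def)

lemma free_carrier_0 [simp]: "0 \<in> free_carrier S"
  by (simp add: free_carrier_def)

lemma free_carrier_var [simp]: "var g \<in> free_carrier S \<longleftrightarrow> g \<in> S"
  by (simp add: free_carrier_def var_def)

lemma free_carrier_add [intro]:
  "p \<in> free_carrier S \<Longrightarrow> q \<in> free_carrier S \<Longrightarrow> p + q \<in> free_carrier S"
  using keys_add[of p q] by (auto simp: free_carrier_def)

lemma free_carrier_mult [intro]:
  "p \<in> free_carrier S \<Longrightarrow> q \<in> free_carrier S \<Longrightarrow> p * q \<in> free_carrier S"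
  using keys_mult[of p q] by (fastforce simp: free_carrier_def letters_plus)

lemma free_carrier_const [intro]:
  "p \<in> free_carrier S \<Longrightarrow> const k * p \<in> free_carrier S"
  using keys_mult[of "const k" p]
  by (fastforce simp: free_carrier_def const_def letters_plus letters_zero split: if_splits)

lemma free_carrier_minus [intro]:
  "p \<in> free_carrier S \<Longrightarrow> q \<in> free_carrier S \<Longrightarrow> p - q \<in> free_carrier S"
  using free_carrier_add[OF _ free_carrier_const[of q S "- 1"], of p] by (simp add: const_minus_1)

lemma free_carrier_sum [intro]:
  "(\<And>x. x \<in> A \<Longrightarrow> f x \<in> free_carrier S) \<Longrightarrow> sum f A \<in> free_carrier S"
  by (induction A rule: infinite_finite_induct) auto

lemma two_sided_ideal_free_algebra:
  "two_sided_ideal (free_algebra S) J \<longleftrightarrow> J \<subseteq> free_carrier S \<and> 0 \<in> J \<and>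
     (\<forall>x \<in> J. \<forall>y \<in> J. x + y \<in> J) \<and> (\<forall>k. \<forall>x \<in> J. const k * x \<in> J) \<and>
     (\<forall>a \<in> free_carrier S. \<forall>x \<in> J. a * x \<in> J \<and> x * a \<in> J)"
  by (simp add: two_sided_ideal_def)

lemma generated_ideal_subset:
  "two_sided_ideal A J \<Longrightarrow> X \<subseteq> J \<Longrightarrow> generated_ideal A X \<subseteq> J"
  by (auto simp: generated_ideal_def)

lemma generated_ideal_superset: "X \<subseteq> generated_ideal A X"
  by (auto simp: generated_ideal_def)

text \<open>The carrier is itself an ideal containing \<open>X\<close>, so the intersection runs
  over a nonempty family and stays inside the carrier.\<close>

lemma two_sided_ideal_generated_free:
  assumes "X \<subseteq> free_carrier S"
  shows "two_sided_ideal (free_algebra S) (generated_ideal (free_algebra S) X)"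
proof -
  have "two_sided_ideal (free_algebra S) (free_carrier S)"
    by (auto simp: two_sided_ideal_free_algebra)
  with assms show ?thesis
    by (subst two_sided_ideal_free_algebra)
       (auto simp: generated_ideal_def two_sided_ideal_free_algebra)
qed

text \<open>Computations in the quotient are carried out on representatives, as membership in
  \<open>R\<close>.\<close>

locale free_ideal =
  fixes S :: "'g set" and R :: "('g word \<Rightarrow>\<^sub>0 'k::field) set"
  assumes ideal: "two_sided_ideal (free_algebra S) R"
begin

abbreviation "C \<equiv> free_carrier S :: ('g word \<Rightarrow>\<^sub>0 'k) set"
abbreviation "L \<equiv> quotient_algebra (free_algebra S) R"
abbreviation "cls \<equiv> ideal_coset (free_algebra S) R"

lemma ideal_carrier: "x \<in> R \<Longrightarrow> x \<in> C"
  and ideal_0 [simp]: "0 \<in> R"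
  and ideal_add: "x \<in> R \<Longrightarrow> y \<in> R \<Longrightarrow> x + y \<in> R"
  and ideal_const: "x \<in> R \<Longrightarrow> const k * x \<in> R"
  and ideal_left: "a \<in> C \<Longrightarrow> x \<in> R \<Longrightarrow> a * x \<in> R"
  and ideal_right: "a \<in> C \<Longrightarrow> x \<in> R \<Longrightarrow> x * a \<in> R"
  using ideal by (auto simp: two_sided_ideal_free_algebra)

lemma ideal_uminus: "x \<in> R \<Longrightarrow> - x \<in> R"
  using ideal_const[of x "- 1"] by (simp add: const_minus_1)

lemma ideal_diff: "x \<in> R \<Longrightarrow> y \<in> R \<Longrightarrow> x - y \<in> R"
  using ideal_add[of x "- y"] by (simp add: ideal_uminus)

lemma ideal_sum: "(\<And>x. x \<in> A \<Longrightarrow> f x \<in> R) \<Longrightarrow> sum f A \<in> R"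
  by (induction A rule: infinite_finite_induct) (auto intro: ideal_add)

lemma mem_cls: "y \<in> cls x \<longleftrightarrow> y - x \<in> R"
  unfolding ideal_coset_def image_iff by (force simp: algebra_simps)

lemma cls_eq: "cls x = cls y \<longleftrightarrow> x - y \<in> R"
proof
  assume "cls x = cls y"
  moreover have "x \<in> cls x"
    by (simp add: mem_cls)
  ultimately show "x - y \<in> R"
    by (simp add: mem_cls)
next
  assume xy: "x - y \<in> R"
  have "z - x \<in> R \<longleftrightarrow> z - y \<in> R" for z
    using ideal_add[OF xy, of "z - x"] ideal_diff[OF _ xy, of "z - y"] by (auto simp: algebra_simps)
  then show "cls x = cls y"
    by (auto simp: mem_cls)
qed

text \<open>Collapses the unions over all representatives in \<open>quotient_algebra\<close> to one
  coset, once the operation respects \<open>R\<close>.\<close>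

lemma cls_union:
  assumes "\<And>x'. x' - x \<in> R \<Longrightarrow> f x' - f x \<in> R"
  shows "(\<Union>x' \<in> cls x. cls (f x')) = cls (f x)"
proof -
  have "cls (f x') = cls (f x)" if "x' \<in> cls x" for x'
    using that assms by (simp add: mem_cls cls_eq)
  moreover have "x \<in> cls x"
    by (simp add: mem_cls)
  ultimately show ?thesis
    by blast
qed

lemma quotient_carrier: "alg_carrier L = cls ` C"
  and quotient_zero: "alg_zero L = cls 0"
  by (simp_all add: quotient_algebra_def)

lemma quotient_add: "alg_add L (cls x) (cls y) = cls (x + y)"
proof -
  have "(\<Union>y' \<in> cls y. cls (x' + y')) = cls (x' + y)" for x'
    by (rule cls_union) (simp add: algebra_simps)
  moreover have "(\<Union>x' \<in> cls x. cls (x' + y)) = cls (x + y)"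
    by (rule cls_union) (simp add: algebra_simps)
  ultimately show ?thesis
    by (simp add: quotient_algebra_def)
qed

lemma quotient_scale: "alg_scale L k (cls x) = cls (const k * x)"
  unfolding quotient_algebra_def
  by simp (rule cls_union, metis ideal_const right_diff_distrib)

lemma quotient_mult:
  assumes x: "x \<in> C" and y: "y \<in> C"
  shows "alg_mult L (cls x) (cls y) = cls (x * y)"
proof -
  \<comment> \<open>\<open>R\<close> absorbs only factors from the carrier, so every representative
    has to be placed in \<open>C\<close> first.\<close>
  have mem: "x' \<in> C" if "x' \<in> cls x" "x \<in> C" for x x'
    using that free_carrier_add[OF ideal_carrier \<open>x \<in> C\<close>, of "x' - x"] by (simp add: mem_cls)
  have "(\<Union>y' \<in> cls y. cls (x' * y')) = cls (x' * y)" if "x' \<in> cls x" for x'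
    by (rule cls_union) (metis ideal_left mem[OF that x] right_diff_distrib)
  moreover have "(\<Union>x' \<in> cls x. cls (x' * y)) = cls (x * y)"
    by (rule cls_union) (metis ideal_right y left_diff_distrib)
  ultimately show ?thesis
    by (simp add: quotient_algebra_def)
qed

text \<open>One half of the correspondence between ideals of the quotient and ideals of the free
  algebra that contain \<open>R\<close>; it lets ideals of \<open>L\<close> be handled on
  representatives.\<close>

definition pullback :: "('g word \<Rightarrow>\<^sub>0 'k) set set \<Rightarrow> ('g word \<Rightarrow>\<^sub>0 'k) set" where
  "pullback J = {x \<in> C. cls x \<in> J}"

lemma pullback_ideal:
  assumes "two_sided_ideal L J"
  shows "two_sided_ideal (free_algebra S) (pullback J)"
proof -
  have "cls 0 \<in> J"
    and "\<And>x y. cls x \<in> J \<Longrightarrow> cls y \<in> J \<Longrightarrow> cls (x + y) \<in> J"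
    and "\<And>k x. cls x \<in> J \<Longrightarrow> cls (const k * x) \<in> J"
    and "\<And>a x. a \<in> C \<Longrightarrow> x \<in> C \<Longrightarrow> cls x \<in> J \<Longrightarrow> cls (a * x) \<in> J \<and> cls (x * a) \<in> J"
    using assms unfolding two_sided_ideal_def
    by (simp_all add: quotient_carrier quotient_zero flip: quotient_add quotient_scale quotient_mult)
  then show ?thesis
    by (auto simp: two_sided_ideal_free_algebra pullback_def)
qed

lemma image_ideal:
  assumes "two_sided_ideal (free_algebra S) K"
  shows "two_sided_ideal L (cls ` K)"
proof -
  have K: "K \<subseteq> C"
    using assms by (auto simp: two_sided_ideal_free_algebra)
  then have "alg_mult L (cls a) (cls x) \<in> cls ` K \<and> alg_mult L (cls x) (cls a) \<in> cls ` K"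
    if "a \<in> C" "x \<in> K" for a x
    using assms that by (auto simp: two_sided_ideal_free_algebra quotient_mult subset_iff)
  with assms K show ?thesis
    unfolding two_sided_ideal_def quotient_carrier quotient_zero
    by (auto simp: quotient_add quotient_scale)
qed

text \<open>The image of \<open>K\<close> is an ideal containing the generators, and
  \<open>K\<close> is the full preimage of its image because it contains \<open>R\<close>. This
  serves as an induction principle for the ideal generated by \<open>H\<close>.\<close>

lemma pullback_generated_subset:
  assumes "two_sided_ideal (free_algebra S) K" "R \<subseteq> K" "X \<subseteq> K"
  shows "pullback (generated_ideal L (cls ` X)) \<subseteq> K"
proof
  fix x assume "x \<in> pullback (generated_ideal L (cls ` X))"
  then have "cls x \<in> cls ` K"
    using generated_ideal_subset[OF image_ideal[OF assms(1)], of "cls ` X"] assms(3)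
    by (auto simp: pullback_def)
  then obtain y where "y \<in> K" "x - y \<in> R"
    by (auto simp: cls_eq)
  with assms have "(x - y) + y \<in> K"
    unfolding two_sided_ideal_free_algebra by blast
  then show "x \<in> K"
    by simp
qed

lemma mem_perp_perp:
  assumes J: "J \<subseteq> alg_carrier L" and x: "x \<in> C"
    and ann: "\<And>a. a \<in> C \<Longrightarrow> (\<forall>y \<in> pullback J. a * y \<in> R \<and> y * a \<in> R) \<Longrightarrow> x * a \<in> R \<and> a * x \<in> R"
  shows "cls x \<in> perp L (perp L J)"
proof -
  have "alg_mult L (cls x) B = alg_zero L \<and> alg_mult L B (cls x) = alg_zero L" if "B \<in> perp L J" for B
  proof -
    from that obtain a where a: "a \<in> C" and B: "B = cls a"
      by (auto simp: perp_def quotient_carrier)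
    have "a * y \<in> R \<and> y * a \<in> R" if "y \<in> pullback J" for y
    proof -
      have "y \<in> C" "cls y \<in> J"
        using that by (auto simp: pullback_def)
      then have "alg_mult L B (cls y) = alg_zero L" "alg_mult L (cls y) B = alg_zero L"
        using \<open>B \<in> perp L J\<close> by (auto simp: perp_def)
      with a B \<open>y \<in> C\<close> show ?thesis
        by (simp add: quotient_mult quotient_zero cls_eq)
    qed
    with ann[OF a] show ?thesis
      using a x B by (simp add: quotient_mult quotient_zero cls_eq)
  qed
  then show ?thesis
    using x by (auto simp: perp_def quotient_carrier)
qed

end

section \<open>Representations of the free algebra\<close>

text \<open>Generators act as linear operators on the space of all functions on \<open>'p\<close>.
  Words act through \<open>foldr\<close>, the leftmost letter last, so products become
  compositions.\<close>

locale word_action =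
  fixes act :: "'g \<Rightarrow> ('p \<Rightarrow> 'k::field) \<Rightarrow> 'p \<Rightarrow> 'k"
  assumes act_add: "act g (\<lambda>b. f b + h b) = (\<lambda>b. act g f b + act g h b)"
    and act_scale: "act g (\<lambda>b. k * f b) = (\<lambda>b. k * act g f b)"
begin

lemma foldr_act_add: "foldr act ls (\<lambda>b. f b + h b) = (\<lambda>b. foldr act ls f b + foldr act ls h b)"
  by (induction ls) (simp_all add: act_add)

lemma foldr_act_scale: "foldr act ls (\<lambda>b. k * f b) = (\<lambda>b. k * foldr act ls f b)"
  by (induction ls) (simp_all add: act_scale)

definition ev :: "('g word \<Rightarrow>\<^sub>0 'k) \<Rightarrow> ('p \<Rightarrow> 'k) \<Rightarrow> 'p \<Rightarrow> 'k" where
  "ev p f = (\<lambda>b. \<Sum>w \<in> Poly_Mapping.keys p. Poly_Mapping.lookup p w * foldr act (letters w) f b)"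

lemma ev_0 [simp]: "ev 0 f = (\<lambda>b. 0)"
  by (simp add: ev_def)

lemma ev_single: "ev (Poly_Mapping.single w k) f = (\<lambda>b. k * foldr act (letters w) f b)"
  by (simp add: ev_def)

lemma ev_add: "ev (p + q) f = (\<lambda>b. ev p f b + ev q f b)"
  unfolding ev_def
  by (rule ext, rule setsum_keys_plus_distrib[where f = "\<lambda>w k. k * foldr act (letters w) f b" for b])
     (simp_all add: algebra_simps)

lemma ev_diff: "ev (p - q) f = (\<lambda>b. ev p f b - ev q f b)"
  using ev_add[of "p - q" q f] by (simp add: fun_eq_iff)

lemma ev_sum: "ev (sum p A) f = (\<lambda>b. \<Sum>x \<in> A. ev (p x) f b)"
  by (induction A rule: infinite_finite_induct) (simp_all add: ev_add)

lemma ev_plus_arg: "ev p (\<lambda>b. f b + h b) = (\<lambda>b. ev p f b + ev p h b)"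
  by (simp add: ev_def foldr_act_add algebra_simps sum.distrib)

lemma ev_zero_arg: "ev p (\<lambda>b. 0) = (\<lambda>b. 0)"
  using foldr_act_scale[where k = 0] by (simp add: ev_def)

lemma ev_mult: "ev (p * q) f = ev p (ev q f)"
proof (induction p rule: poly_mapping_add_induct)
  case (single w k)
  show ?case
    by (induction q rule: poly_mapping_add_induct)
       (simp_all add: mult_single ev_single letters_plus foldr_act_scale algebra_simps
          ev_add ev_plus_arg ev_zero_arg)
qed (simp_all add: algebra_simps ev_add)

lemma ev_const_mult: "ev (const k * p) f = (\<lambda>b. k * ev p f b)"
  by (simp add: ev_mult const_def ev_single letters_zero)

lemma ev_var [simp]: "ev (var g) f = act g f"
  by (simp add: var_def ev_single)

text \<open>The annihilator of the module. An ideal whose generators act as zero lies in it, so one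
  function that is not sent to zero shows that an element is outside that ideal.\<close>

definition kernel :: "'g set \<Rightarrow> ('g word \<Rightarrow>\<^sub>0 'k) set" where
  "kernel S = {p \<in> free_carrier S. \<forall>f. ev p f = (\<lambda>b. 0)}"

lemma kernel_ideal: "two_sided_ideal (free_algebra S) (kernel S)"
  unfolding two_sided_ideal_free_algebra kernel_def
  by (auto simp: ev_add ev_mult ev_zero_arg ev_const_mult simp del: mult_eq_0_iff)

end

section \<open>A representation that kills exactly the vertices of a hereditary saturated set\<close>

lemma (in wf_digraph) hereditary_head:
  assumes "hereditary G H" "e \<in> arcs G" "tail G e \<in> H"
  shows "head G e \<in> H"
  using assms arc_implies_awalk[of e] by (auto simp: hereditary_def)

definition surviving_arcs :: "('v, 'e) pre_digraph \<Rightarrow> 'v set \<Rightarrow> 'v \<Rightarrow> 'e set" where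
  "surviving_arcs E H v = {e \<in> out_arcs E v. head E e \<notin> H}"

text \<open>
  The point \<open>(v, m)\<close> with \<open>branching E H v m = (e, n)\<close> plays the role of the infinite path that
  starts with \<open>e\<close> and continues as \<open>(head E e, n)\<close>; a bijection from the copy of the natural numbers
  over \<open>v\<close> onto the disjoint union of those over the ranges of the edges at \<open>v\<close> is all that is
  needed of infinite paths. Without surviving edges at \<open>v\<close> the choice is junk and never used.
\<close>

definition branching :: "('v, 'e) pre_digraph \<Rightarrow> 'v set \<Rightarrow> 'v \<Rightarrow> nat \<Rightarrow> 'e \<times> nat" where
  "branching E H v = (SOME b. bij_betw b UNIV (surviving_arcs E H v \<times> UNIV))"

text \<open>Row-finiteness makes the product countable, and a surviving edge makes it infinite;
  hence it is in bijection with the natural numbers.\<close>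

lemma bij_branching:
  assumes "row_finite E" "v \<in> verts E" "surviving_arcs E H v \<noteq> {}"
  shows "bij_betw (branching E H v) UNIV (surviving_arcs E H v \<times> UNIV)"
proof -
  let ?A = "surviving_arcs E H v \<times> (UNIV :: nat set)"
  have "finite (surviving_arcs E H v)"
    by (rule finite_subset[of _ "out_arcs E v"])
       (use assms(1,2) in \<open>auto simp: surviving_arcs_def row_finite_def\<close>)
  then have "countable ?A"
    by (intro countable_SIGMA) (simp_all add: countable_finite)
  moreover have "infinite ?A"
  proof
    assume "finite ?A"
    then have "finite (snd ` ?A)"
      by (rule finite_imageI)
    with assms(3) show False
      by (simp add: snd_image_times)
  qed
  ultimately have "bij_betw (from_nat_into ?A) UNIV ?A"
    by (rule bij_betw_from_nat_into)
  then show ?thesis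
    unfolding branching_def by (rule someI[where P = "\<lambda>b. bij_betw b UNIV ?A"])
qed

text \<open>The action on functions of infinite paths: \<open>Edge e\<close> evaluates at the path
  with its first edge \<open>e\<close> removed, \<open>Ghost e\<close> at the path with
  \<open>e\<close> put in front. Wherever this makes no sense, or a vertex in \<open>H\<close> is
  involved, the value is 0.\<close>

fun branch_act ::
    "('v, 'e) pre_digraph \<Rightarrow> 'v set \<Rightarrow> ('v, 'e) generator \<Rightarrow> ('v \<times> nat \<Rightarrow> 'k) \<Rightarrow> 'v \<times> nat \<Rightarrow> 'k::field" where
  "branch_act E H (Vertex v) f (w, m) = (if w = v \<and> v \<notin> H then f (w, m) else 0)"
| "branch_act E H (Edge e) f (w, m) =
     (if e \<in> surviving_arcs E H w \<and> fst (branching E H w m) = e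
      then f (head E e, snd (branching E H w m)) else 0)"
| "branch_act E H (Ghost e) f (w, m) =
     (if w = head E e \<and> w \<notin> H
      then f (tail E e, inv_into UNIV (branching E H (tail E e)) (e, m)) else 0)"

interpretation branch: word_action "branch_act E H" for E H
proof (unfold_locales, goal_cases)
  case (1 g f h)
  show ?case
    by (rule ext, rename_tac b, case_tac b, case_tac g) auto
next
  case (2 g k f)
  show ?case
    by (rule ext, rename_tac b, case_tac b, case_tac g) auto
qed

lemma mem_generators [simp]:
  "Vertex v \<in> generators E \<longleftrightarrow> v \<in> verts E"
  "Edge e \<in> generators E \<longleftrightarrow> e \<in> arcs E"
  "Ghost e \<in> generators E \<longleftrightarrow> e \<in> arcs E"
  by (auto simp: generators_def)

lemma relators_cases [consumes 1, case_names idem orth tail_edge edge_head head_ghost ghost_tail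
    ghost_edge ghost_edge_orth expand]:
  assumes "r \<in> relators E"
  obtains v where "v \<in> verts E" "r = var (Vertex v) * var (Vertex v) - var (Vertex v)"
  | v w where "v \<in> verts E" "w \<in> verts E" "v \<noteq> w" "r = var (Vertex v) * var (Vertex w)"
  | e where "e \<in> arcs E" "r = var (Vertex (tail E e)) * var (Edge e) - var (Edge e)"
  | e where "e \<in> arcs E" "r = var (Edge e) * var (Vertex (head E e)) - var (Edge e)"
  | e where "e \<in> arcs E" "r = var (Vertex (head E e)) * var (Ghost e) - var (Ghost e)"
  | e where "e \<in> arcs E" "r = var (Ghost e) * var (Vertex (tail E e)) - var (Ghost e)"
  | e where "e \<in> arcs E" "r = var (Ghost e) * var (Edge e) - var (Vertex (head E e))"
  | e f where "e \<in> arcs E" "f \<in> arcs E" "e \<noteq> f" "r = var (Ghost e) * var (Edge f)"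
  | v where "v \<in> regular_verts E"
      "r = var (Vertex v) - (\<Sum>e \<in> out_arcs E v. var (Edge e) * var (Ghost e))"
  using assms unfolding relators_def
  by (elim UnE CollectE exE conjE) (rule that, assumption+)+

lemma finite_out_arcs_regular: "v \<in> regular_verts E \<Longrightarrow> finite (out_arcs E v)"
  by (simp add: regular_verts_def)

lemma relators_carrier: "relators E \<subseteq> free_carrier (generators E)" if "wf_digraph E"
proof -
  interpret wf_digraph E by fact
  show ?thesis
    by (auto simp: relators_def regular_verts_def intro!: free_carrier_mult free_carrier_minus free_carrier_sum)
qed

text \<open>Heredity puts the source of every surviving edge outside \<open>H\<close>, so that
  vertices absorb edges correctly. Saturation gives each regular vertex outside \<open>H\<close> a
  surviving edge, so that each of its points has a first edge and the expansion of the vertex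
  holds.\<close>

lemma relators_kernel:
  fixes E :: "('v, 'e) pre_digraph"
  assumes wf: "wf_digraph E" and rf: "row_finite E"
    and sat: "saturated E H" and her: "hereditary E H"
  shows "(relators E :: (('v, 'e) generator word \<Rightarrow>\<^sub>0 'k::field) set)
    \<subseteq> branch.kernel E H (generators E)"
proof
  interpret wf_digraph E by fact
  fix r :: "('v, 'e) generator word \<Rightarrow>\<^sub>0 'k"
  assume r: "r \<in> relators E"
  then have car: "r \<in> free_carrier (generators E)"
    using relators_carrier[OF wf] by blast
  note act = branch.ev_diff branch.ev_mult branch.ev_sum
  have bij: "bij_betw (branching E H (tail E e)) UNIV (surviving_arcs E H (tail E e) \<times> UNIV)"
    if "e \<in> arcs E" "head E e \<notin> H" for e
    by (rule bij_branching) (use that rf in \<open>auto simp: surviving_arcs_def\<close>)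
  have right_inv: "branching E H (tail E e) (inv_into UNIV (branching E H (tail E e)) (e, m)) = (e, m)"
    if "e \<in> arcs E" "head E e \<notin> H" for e m
    using bij_betw_inv_into_right[OF bij[OF that], of "(e, m)"] that by (auto simp: surviving_arcs_def)
  have left_inv: "inv_into UNIV (branching E H (tail E e)) (branching E H (tail E e) m) = m"
    if "e \<in> arcs E" "head E e \<notin> H" for e m
    using bij_betw_inv_into_left[OF bij[OF that], of m] by simp
  have tail_H: "tail E e \<notin> H" if "e \<in> arcs E" "head E e \<notin> H" for e
    using hereditary_head[OF her] that by blast
  have CK: "(\<Sum>e \<in> out_arcs E v. branch_act E H (Edge e) (branch_act E H (Ghost e) f) (w, m)) =
      branch_act E H (Vertex v) f (w, m)" (is "?lhs = ?rhs")
    if v: "v \<in> regular_verts E" for v f w m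
  proof (cases "w = v \<and> v \<notin> H")
    case False
    have "\<not> (e \<in> out_arcs E v \<and> e \<in> surviving_arcs E H w)" for e
      using False tail_H by (auto simp: surviving_arcs_def)
    then have "?lhs = 0"
      by (intro sum.neutral) auto
    also have "\<dots> = ?rhs"
      using False by auto
    finally show ?thesis .
  next
    case True
    then have w [simp]: "w = v" and vH: "v \<notin> H"
      by auto
    have "\<not> head E ` out_arcs E v \<subseteq> H"
      using sat v vH unfolding saturated_def by blast
    then obtain e0 where "e0 \<in> out_arcs E v" "head E e0 \<notin> H"
      by blast
    then have "bij_betw (branching E H v) UNIV (surviving_arcs E H v \<times> UNIV)"
      using bij[of e0] by auto
    then have "branching E H v m \<in> surviving_arcs E H v \<times> UNIV"
      by (auto simp: bij_betw_def)
    then obtain e n where en: "branching E H v m = (e, n)" and e: "e \<in> surviving_arcs E H v"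
      by auto
    have e': "e \<in> arcs E" "tail E e = v" "head E e \<notin> H"
      using e by (auto simp: surviving_arcs_def)
    \<comment> \<open>Only the first edge of the point \<open>(v, m)\<close> contributes: removing
      it and putting it back returns to \<open>(v, m)\<close>.\<close>
    have "?lhs = (\<Sum>e' \<in> out_arcs E v. if e' = e then f (v, m) else 0)"
    proof (rule sum.cong)
      fix e' assume "e' \<in> out_arcs E v"
      show "branch_act E H (Edge e') (branch_act E H (Ghost e') f) (w, m) =
          (if e' = e then f (v, m) else 0)"
        using e e' en left_inv[of e m] by simp
    qed simp
    also have "\<dots> = f (v, m)"
      using e' finite_out_arcs_regular[OF v] by simp
    finally show ?thesis
      using vH by simp
  qed
  have ev: "branch.ev E H r f (w, m) = 0" for f w m
    using r
  proof (cases rule: relators_cases)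
    case (expand v)
    then show ?thesis
      by (simp add: act CK del: branch_act.simps)
  next
    case (tail_edge e)
    then show ?thesis
      using tail_H[of e] by (auto simp: act surviving_arcs_def)
  next
    case (ghost_edge e)
    then show ?thesis
      by (simp add: act right_inv surviving_arcs_def)
  next
    case (ghost_edge_orth e f)
    then show ?thesis
      using right_inv[of e m] by (auto simp: act surviving_arcs_def)
  next
    case (ghost_tail e)
    then show ?thesis
      using tail_H[of e] by (auto simp: act)
  next
    case (idem v)
    then show ?thesis
      by (simp add: act)
  next
    case (orth v w)
    then show ?thesis
      by (simp add: act)
  next
    case (edge_head e)
    then show ?thesis
      by (simp add: act surviving_arcs_def)
  next
    case (head_ghost e)
    then show ?thesis
      by (auto simp: act)
  qed
  have "branch.ev E H r f = (\<lambda>b. 0)" for f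
  proof
    fix b show "branch.ev E H r f b = 0"
      by (cases b) (simp only: ev)
  qed
  then show "r \<in> branch.kernel E H (generators E)"
    using car unfolding branch.kernel_def by blast
qed

section \<open>Paths and ghost paths modulo the relations\<close>

text \<open>The vertex argument is the range of the path. It stands in for the missing unit on the
  empty path and does not change when the first edge is removed.\<close>

primrec real_path :: "'v \<Rightarrow> 'e list \<Rightarrow> ('v, 'e) generator word \<Rightarrow>\<^sub>0 'k::field" where
  "real_path v [] = var (Vertex v)"
| "real_path v (e # p) = var (Edge e) * real_path v p"

primrec ghost_path :: "'v \<Rightarrow> 'e list \<Rightarrow> ('v, 'e) generator word \<Rightarrow>\<^sub>0 'k::field" where
  "ghost_path v [] = var (Vertex v)"
| "ghost_path v (e # p) = ghost_path v p * var (Ghost e)"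

text \<open>The reductions below use only that the relations hold modulo \<open>R\<close>; that
  certain elements do not vanish is a separate matter, settled by the representation.\<close>

locale leavitt = wf_digraph E + free_ideal "generators E" R
  for E :: "('v, 'e) pre_digraph" and R :: "(('v, 'e) generator word \<Rightarrow>\<^sub>0 'k::field) set" +
  assumes relators: "relators E \<subseteq> R"
begin

definition cong :: "(('v, 'e) generator word \<Rightarrow>\<^sub>0 'k) \<Rightarrow> (('v, 'e) generator word \<Rightarrow>\<^sub>0 'k) \<Rightarrow> bool"
    (infix \<open>\<approx>\<close> 50) where
  "x \<approx> y \<longleftrightarrow> x - y \<in> R"

lemma cong_refl [simp]: "x \<approx> x"
  by (simp add: cong_def)

lemma cong_sym: "x \<approx> y \<Longrightarrow> y \<approx> x"
  using ideal_uminus[of "x - y"] by (simp add: cong_def)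

lemma cong_trans [trans]: "x \<approx> y \<Longrightarrow> y \<approx> z \<Longrightarrow> x \<approx> z"
  using ideal_add[of "x - y" "y - z"] by (simp add: cong_def)

lemma cong_left: "a \<in> C \<Longrightarrow> x \<approx> y \<Longrightarrow> a * x \<approx> a * y"
  using ideal_left[of a "x - y"] by (simp add: cong_def right_diff_distrib)

lemma cong_right: "a \<in> C \<Longrightarrow> x \<approx> y \<Longrightarrow> x * a \<approx> y * a"
  using ideal_right[of a "x - y"] by (simp add: cong_def left_diff_distrib)

lemma cong_const: "x \<approx> y \<Longrightarrow> const k * x \<approx> const k * y"
  using ideal_const[of "x - y" k] by (simp add: cong_def right_diff_distrib)

lemma cong_sum: "(\<And>x. x \<in> A \<Longrightarrow> f x \<approx> g x) \<Longrightarrow> sum f A \<approx> sum g A"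
  using ideal_sum[of A "\<lambda>x. f x - g x"] by (simp add: cong_def sum_subtractf)

lemma cong_0: "x \<approx> 0 \<longleftrightarrow> x \<in> R"
  by (simp add: cong_def)

lemma cong_mem: "x \<approx> y \<Longrightarrow> x \<in> R \<longleftrightarrow> y \<in> R"
  using cong_trans cong_sym cong_0 by metis

abbreviation V :: "'v \<Rightarrow> ('v, 'e) generator word \<Rightarrow>\<^sub>0 'k" where "V v \<equiv> var (Vertex v)"
abbreviation X :: "'e \<Rightarrow> ('v, 'e) generator word \<Rightarrow>\<^sub>0 'k" where "X e \<equiv> var (Edge e)"
abbreviation Y :: "'e \<Rightarrow> ('v, 'e) generator word \<Rightarrow>\<^sub>0 'k" where "Y e \<equiv> var (Ghost e)"

lemma vertex_idem: "v \<in> verts E \<Longrightarrow> V v * V v \<approx> V v"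
  and vertex_orth: "v \<in> verts E \<Longrightarrow> w \<in> verts E \<Longrightarrow> v \<noteq> w \<Longrightarrow> V v * V w \<in> R"
  and tail_edge: "e \<in> arcs E \<Longrightarrow> V (tail E e) * X e \<approx> X e"
  and head_ghost: "e \<in> arcs E \<Longrightarrow> V (head E e) * Y e \<approx> Y e"
  and ghost_tail: "e \<in> arcs E \<Longrightarrow> Y e * V (tail E e) \<approx> Y e"
  and ghost_edge: "e \<in> arcs E \<Longrightarrow> Y e * X e \<approx> V (head E e)"
  and ghost_edge_orth: "e \<in> arcs E \<Longrightarrow> f \<in> arcs E \<Longrightarrow> e \<noteq> f \<Longrightarrow> Y e * X f \<in> R"
  and vertex_expand: "v \<in> regular_verts E \<Longrightarrow> V v \<approx> (\<Sum>e \<in> out_arcs E v. X e * Y e)"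
  unfolding cong_def by (rule subsetD[OF relators], unfold relators_def, blast)+

lemma path_carrier:
  assumes "awalk u p v"
  shows "ghost_path v p \<in> C" and "real_path v p \<in> C"
  using assms by (induction p arbitrary: u) (auto simp: awalk_Nil_iff awalk_Cons_iff intro!: free_carrier_mult)

lemma ghost_path_tail: "awalk u p v \<Longrightarrow> ghost_path v p * V u \<approx> ghost_path v p"
proof (induction p arbitrary: u)
  case Nil
  then show ?case
    by (auto simp: awalk_Nil_iff vertex_idem)
next
  case (Cons e p)
  then show ?case
    using cong_left[OF path_carrier(1)[of "head E e" p v] ghost_tail[of e]]
    by (auto simp: awalk_Cons_iff mult.assoc)
qed

lemma tail_real_path: "awalk u p v \<Longrightarrow> V u * real_path v p \<approx> real_path v p"
proof (induction p arbitrary: u)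
  case Nil
  then show ?case
    by (auto simp: awalk_Nil_iff vertex_idem)
next
  case (Cons e p)
  then show ?case
    using cong_right[OF path_carrier(2)[of "head E e" p v] tail_edge[of e]]
    by (auto simp: awalk_Cons_iff mult.assoc)
qed

section \<open>Products of ghost paths with paths\<close>

lemma vertex_real_path_orth:
  assumes "awalk u p v" "u' \<in> verts E" "u' \<noteq> u"
  shows "V u' * real_path v p \<in> R"
proof -
  have "u \<in> verts E"
    using assms by auto
  then have "V u' * V u * real_path v p \<in> R"
    using assms by (intro ideal_right path_carrier vertex_orth) auto
  moreover have "V u' * (V u * real_path v p) \<approx> V u' * real_path v p"
    using assms by (intro cong_left tail_real_path) auto
  ultimately show ?thesis
    by (simp add: mult.assoc cong_mem)
qed

lemma ghost_real_cancel:
  assumes "awalk u (e # p) v" "awalk u' (e # q) w"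
  shows "ghost_path v (e # p) * real_path w (e # q) \<approx> ghost_path v p * real_path w q"
proof -
  have e: "e \<in> arcs E" and p: "awalk (head E e) p v" and q: "awalk (head E e) q w"
    using assms by (auto simp: awalk_Cons_iff)
  have "(Y e * X e) * real_path w q \<approx> V (head E e) * real_path w q"
    by (intro cong_right path_carrier[OF q] ghost_edge e)
  also have "\<dots> \<approx> real_path w q"
    by (rule tail_real_path[OF q])
  finally have "ghost_path v p * ((Y e * X e) * real_path w q) \<approx> ghost_path v p * real_path w q"
    by (intro cong_left path_carrier[OF p])
  then show ?thesis
    by (simp add: mult.assoc)
qed

lemma ghost_real_append:
  "awalk u p v \<Longrightarrow> awalk v q w \<Longrightarrow> ghost_path v p * real_path w (p @ q) \<approx> real_path w q"
proof (induction p arbitrary: u)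
  case Nil
  then show ?case
    by (auto simp: awalk_Nil_iff tail_real_path)
next
  case (Cons e p)
  then have "awalk u (e # p @ q) w"
    by (metis append_Cons awalk_appendI)
  then show ?case
    using Cons cong_trans[OF ghost_real_cancel] by (simp add: awalk_Cons_iff)
qed

text \<open>Common first edges cancel until the paths diverge at edges \<open>e\<close> and
  \<open>f\<close>, where the product of \<open>Ghost e\<close> and \<open>Edge f\<close> vanishes.
  Since neither path is a prefix of the other, this happens before one of them is exhausted.\<close>

lemma ghost_real_orth:
  "awalk u p v \<Longrightarrow> awalk u' q w \<Longrightarrow> \<not> prefix p q \<Longrightarrow> \<not> prefix q p \<Longrightarrow>
    ghost_path v p * real_path w q \<in> R"
proof (induction p arbitrary: u u' q)
  case (Cons e p)
  then obtain f q' where q: "q = f # q'"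
    by (cases q) auto
  show ?case
  proof (cases "e = f")
    case True
    with Cons q have "ghost_path v p * real_path w q' \<in> R"
      by (auto simp: awalk_Cons_iff)
    then show ?thesis
      using ghost_real_cancel Cons.prems q True cong_mem by blast
  next
    case False
    have "ghost_path v p * ((Y e * X f) * real_path w q') \<in> R"
      using Cons.prems q False
      by (intro ideal_left ideal_right path_carrier ghost_edge_orth) (auto simp: awalk_Cons_iff)
    then show ?thesis
      by (simp add: q mult.assoc)
  qed
qed simp

text \<open>A vertex fixes the ghost path or kills it, an edge removes the first edge or kills it,
  and a ghost edge lengthens it or kills it. As \<open>p\<close> is nonempty, an edge always meets a
  ghost edge to cancel with, and the length drops by at most one.\<close>

lemma ghost_path_generator:
  assumes p: "awalk u p v" and "p \<noteq> []" and g: "g \<in> generators E"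
  shows "ghost_path v p * var g \<in> R \<or>
    (\<exists>u' q. awalk u' q v \<and> length p \<le> Suc (length q) \<and> ghost_path v p * var g \<approx> ghost_path v q)"
proof -
  have u: "u \<in> verts E"
    using p by auto
  obtain e p' where pe: "p = e # p'"
    using \<open>p \<noteq> []\<close> by (cases p) auto
  then have e: "e \<in> arcs E" "tail E e = u" and p': "awalk (head E e) p' v"
    using p by (auto simp: awalk_Cons_iff)
  have orth: "ghost_path v p * x \<in> R" if "x \<in> C" "V u * x \<in> R" for x
  proof -
    have "ghost_path v p * V u * x \<approx> ghost_path v p * x"
      using that p by (intro cong_right ghost_path_tail)
    then show ?thesis
      using ideal_left[OF path_carrier(1)[OF p] that(2)] by (simp add: mult.assoc cong_mem)
  qed
  show ?thesis
  proof (cases g)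
    case (Vertex w)
    then have w: "w \<in> verts E"
      using g by (auto simp: generators_def)
    show ?thesis
    proof (cases "w = u")
      case True
      then show ?thesis
        using p ghost_path_tail[OF p] Vertex by auto
    next
      case False
      then show ?thesis
        using orth[of "V w"] vertex_orth[of u w] u w Vertex by auto
    qed
  next
    case (Edge f)
    then have f: "f \<in> arcs E"
      using g by (auto simp: generators_def)
    show ?thesis
    proof (cases "f = e")
      case True
      have "ghost_path v p' * (Y e * X e) \<approx> ghost_path v p' * V (head E e)"
        by (intro cong_left path_carrier[OF p'] ghost_edge e)
      also have "\<dots> \<approx> ghost_path v p'"
        by (rule ghost_path_tail[OF p'])
      finally have "ghost_path v p * var g \<approx> ghost_path v p'"
        by (simp add: pe Edge True mult.assoc)
      then show ?thesis
        using p' pe by auto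
    next
      case False
      have "ghost_path v p' * (Y e * X f) \<in> R"
        using e f False by (intro ideal_left path_carrier[OF p'] ghost_edge_orth) auto
      then show ?thesis
        by (simp add: pe Edge mult.assoc)
    qed
  next
    case (Ghost f)
    then have f: "f \<in> arcs E"
      using g by (auto simp: generators_def)
    show ?thesis
    proof (cases "head E f = u")
      case True
      then have "awalk (tail E f) (f # p) v"
        using f p by (auto simp: awalk_Cons_iff)
      moreover have "ghost_path v p * var g = ghost_path v (f # p)"
        by (simp add: Ghost)
      ultimately show ?thesis
        by (metis cong_refl le_SucI length_Cons order_refl)
    next
      case False
      have "V u * V (head E f) * Y f \<in> R"
        using False f u by (intro ideal_right vertex_orth) auto
      then have "V u * (V (head E f) * Y f) \<in> R"
        by (simp add: mult.assoc)
      moreover have "V u * (V (head E f) * Y f) \<approx> V u * Y f"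
        using f u by (intro cong_left head_ghost) auto
      ultimately show ?thesis
        using orth[of "Y f"] f Ghost by (auto simp: cong_mem)
    qed
  qed
qed

text \<open>Each letter uses up at most one edge, so a path at least as long as the word outlasts
  it, and no real edges are left over.\<close>

lemma ghost_path_word:
  assumes p: "awalk u p v"
  shows "set ls \<subseteq> generators E \<Longrightarrow> length ls \<le> length p \<Longrightarrow>
    ghost_path v p * Poly_Mapping.single (Word ls) 1 \<in> R \<or>
    (\<exists>u' q. awalk u' q v \<and> length p \<le> length ls + length q \<and>
       ghost_path v p * Poly_Mapping.single (Word ls) 1 \<approx> ghost_path v q)"
proof (induction ls rule: rev_induct)
  case Nil
  have "Poly_Mapping.single (Word []) 1 = (1 :: ('v, 'e) generator word \<Rightarrow>\<^sub>0 'k)"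
    by (simp add: zero_word_def flip: single_one)
  then show ?case
    using p by (auto intro!: disjI2 exI[of _ u] exI[of _ p])
next
  case (snoc g ls)
  let ?w = "Poly_Mapping.single (Word ls) (1 :: 'k)"
  have g: "g \<in> generators E"
    using snoc.prems by simp
  have split: "ghost_path v p * Poly_Mapping.single (Word (ls @ [g])) 1 = ghost_path v p * ?w * var g"
    by (simp add: var_def mult_single plus_word_def mult.assoc)
  consider "ghost_path v p * ?w \<in> R"
    | u' q where "awalk u' q v" "length p \<le> length ls + length q" "ghost_path v p * ?w \<approx> ghost_path v q"
    using snoc by auto
  then show ?case
  proof cases
    case 1
    then show ?thesis
      unfolding split using ideal_right[of "var g"] g by simp
  next
    case 2
    then have *: "ghost_path v p * ?w * var g \<approx> ghost_path v q * var g"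
      using g by (intro cong_right) auto
    \<comment> \<open>\<open>ls\<close> is strictly shorter than \<open>p\<close>, so at least one
      edge is left for the last letter \<open>g\<close>.\<close>
    have "q \<noteq> []"
      using 2(2) snoc.prems by auto
    from ghost_path_generator[OF 2(1) this g] show ?thesis
    proof
      assume "ghost_path v q * var g \<in> R"
      then show ?thesis
        unfolding split using * by (simp add: cong_mem)
    next
      assume "\<exists>u'' q'. awalk u'' q' v \<and> length q \<le> Suc (length q') \<and>
        ghost_path v q * var g \<approx> ghost_path v q'"
      then obtain u'' q' where "awalk u'' q' v" "length q \<le> Suc (length q')"
        "ghost_path v q * var g \<approx> ghost_path v q'"
        by blast
      then show ?thesis
        unfolding split using cong_trans[OF *] 2(2)
        by (intro disjI2 exI[of _ u''] exI[of _ q']) auto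
    qed
  qed
qed

lemma ghost_path_mult_combination:
  assumes p: "awalk u p v" and a: "a \<in> C"
    and len: "\<And>w. w \<in> Poly_Mapping.keys a \<Longrightarrow> length (letters w) \<le> length p"
  obtains M k where "finite M" "\<And>q. q \<in> M \<Longrightarrow> \<exists>u'. awalk u' q v"
    "ghost_path v p * a \<approx> (\<Sum>q \<in> M. const (k q) * ghost_path v q)"
proof -
  let ?A = "Poly_Mapping.keys a"
  let ?t = "\<lambda>w. ghost_path v p * Poly_Mapping.single w (1 :: 'k)"
  define B where "B = {w \<in> ?A. ?t w \<notin> R}"
  have "\<exists>q. (\<exists>u'. awalk u' q v) \<and> ?t w \<approx> ghost_path v q" if "w \<in> B" for w
    using ghost_path_word[OF p, of "letters w"] len[of w] a that
    by (auto simp: B_def free_carrier_def)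
  then obtain m where m: "\<And>w. w \<in> B \<Longrightarrow> (\<exists>u'. awalk u' (m w) v) \<and> ?t w \<approx> ghost_path v (m w)"
    by metis
  let ?c = "\<lambda>w. const (Poly_Mapping.lookup a w)"
  \<comment> \<open>Different words may reduce to the same ghost path, so coefficients are added
    over the fibres of \<open>m\<close>.\<close>
  let ?k = "\<lambda>q. \<Sum>w \<in> {w \<in> B. m w = q}. Poly_Mapping.lookup a w"
  have "Poly_Mapping.single w (Poly_Mapping.lookup a w) = ?c w * Poly_Mapping.single w 1" for w
    by (simp add: const_def mult_single)
  then have "a = (\<Sum>w \<in> ?A. ?c w * Poly_Mapping.single w 1)"
    using poly_mapping_sum_single[of a] by simp
  then have "ghost_path v p * a = (\<Sum>w \<in> ?A. ?c w * ?t w)"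
    by (metis (no_types, lifting) const_left_commute sum.cong sum_distrib_left)
  also have "\<dots> \<approx> (\<Sum>w \<in> ?A. if w \<in> B then ?c w * ghost_path v (m w) else 0)"
  proof (rule cong_sum)
    fix w assume "w \<in> ?A"
    then have "?t w \<in> R" if "w \<notin> B"
      using that by (simp add: B_def)
    then show "?c w * ?t w \<approx> (if w \<in> B then ?c w * ghost_path v (m w) else 0)"
      using m[of w] by (simp add: cong_const cong_0 ideal_const)
  qed
  also have "(\<Sum>w \<in> ?A. if w \<in> B then ?c w * ghost_path v (m w) else 0) = (\<Sum>w \<in> B. ?c w * ghost_path v (m w))"
    by (simp add: sum.If_cases B_def Collect_conj_eq Int_commute)
  also have "\<dots> = (\<Sum>q \<in> m ` B. \<Sum>w \<in> {w \<in> B. m w = q}. ?c w * ghost_path v (m w))"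
    by (rule sum.image_gen) (simp add: B_def)
  also have "\<dots> = (\<Sum>q \<in> m ` B. const (?k q) * ghost_path v q)"
    by (simp add: const_sum sum_distrib_right)
  finally show thesis
    using m by (intro that[of "m ` B" ?k]) (auto simp: B_def)
qed

end

section \<open>The involution\<close>

primrec star_gen :: "('v, 'e) generator \<Rightarrow> ('v, 'e) generator" where
  "star_gen (Vertex v) = Vertex v"
| "star_gen (Edge e) = Ghost e"
| "star_gen (Ghost e) = Edge e"

definition star_word :: "('v, 'e) generator word \<Rightarrow> ('v, 'e) generator word" where
  "star_word w = Word (rev (map star_gen (letters w)))"

text \<open>\<open>map_key\<close> precomposes with \<open>star_word\<close>, which is its own
  inverse; hence each word is moved to its reversed, starred word, and scalars stay fixed.\<close>

definition star :: "(('v, 'e) generator word \<Rightarrow>\<^sub>0 'k::field) \<Rightarrow> ('v, 'e) generator word \<Rightarrow>\<^sub>0 'k" where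
  "star p = Poly_Mapping.map_key star_word p"

lemma star_gen_star_gen [simp]: "star_gen (star_gen g) = g"
  by (cases g) auto

lemma star_gen_generators [simp]: "star_gen g \<in> generators E \<longleftrightarrow> g \<in> generators E"
  by (cases g) auto

lemma star_word_star_word [simp]: "star_word (star_word w) = w"
  by (simp add: star_word_def rev_map comp_def)

lemma inj_star_word: "inj star_word"
  by (metis injI star_word_star_word)

lemma star_word_plus: "star_word (u + w) = star_word w + star_word u"
  by (simp add: star_word_def plus_word_def)

lemma star_single [simp]: "star (Poly_Mapping.single w k) = Poly_Mapping.single (star_word w) k"
  using map_key_single[OF inj_star_word, of "star_word w" k] by (simp add: star_def)

lemma star_0 [simp]: "star 0 = 0"
  by (simp add: star_def inj_star_word)

lemma star_add [simp]: "star (p + q) = star p + star q"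
  by (simp add: star_def map_key_plus inj_star_word)

lemma star_diff [simp]: "star (p - q) = star p - star q"
  using star_add[of "p - q" q] by (simp add: algebra_simps)

lemma star_sum [simp]: "star (sum f A) = (\<Sum>x \<in> A. star (f x))"
  by (induction A rule: infinite_finite_induct) simp_all

lemma star_var [simp]: "star (var g) = var (star_gen g)"
  by (simp add: var_def star_word_def)

lemma star_const [simp]: "star (const k) = const k"
  by (simp add: const_def star_word_def zero_word_def)

lemma star_mult [simp]: "star (p * q) = star q * star p"
proof (induction p rule: poly_mapping_add_induct)
  case (single w k)
  show ?case
    by (induction q rule: poly_mapping_add_induct)
       (simp_all add: mult_single star_word_plus algebra_simps)
qed (simp_all add: algebra_simps)

lemma star_star [simp]: "star (star p) = p"
  by (induction p rule: poly_mapping_add_induct) simp_all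

lemma star_free_carrier [simp]:
  fixes E :: "('v, 'e) pre_digraph" and p :: "('v, 'e) generator word \<Rightarrow>\<^sub>0 'k::field"
  shows "star p \<in> free_carrier (generators E) \<longleftrightarrow> p \<in> free_carrier (generators E)"
proof -
  have "star q \<in> free_carrier (generators E)" if q: "q \<in> free_carrier (generators E)"
    for q :: "('v, 'e) generator word \<Rightarrow>\<^sub>0 'k"
  proof -
    have "letters (star_word w) \<noteq> [] \<and> set (letters (star_word w)) \<subseteq> generators E"
      if "w \<in> Poly_Mapping.keys q" for w
    proof -
      have "letters w \<noteq> [] \<and> set (letters w) \<subseteq> generators E"
        using q that by (simp add: free_carrier_def)
      then show ?thesis
        by (auto simp: star_word_def)
    qed
    moreover have "star_word w \<in> Poly_Mapping.keys q" if "w \<in> Poly_Mapping.keys (star q)" for w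
      using that by (simp add: star_def keys_map_key inj_star_word)
    ultimately show ?thesis
      unfolding free_carrier_def by (intro CollectI ballI) (metis star_word_star_word)
  qed
  from this[of p] this[of "star p"] show ?thesis
    by auto
qed

lemma star_ideal:
  assumes "two_sided_ideal (free_algebra (generators E)) J"
  shows "two_sided_ideal (free_algebra (generators E)) {x \<in> free_carrier (generators E). star x \<in> J}"
  using assms unfolding two_sided_ideal_free_algebra
  by (auto simp: const_commute)

text \<open>The relations for sources and ranges of edges are exchanged with those for ghost edges;
  the others are sent to relations of their own kind.\<close>

lemma star_relators: "r \<in> relators E \<Longrightarrow> star r \<in> relators E"
  by (cases r rule: relators_cases, assumption) (auto simp: relators_def)

lemma relation_ideal_ideal:
  "wf_digraph E \<Longrightarrow> two_sided_ideal (free_algebra (generators E)) (relation_ideal E)"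
  unfolding relation_ideal_def by (intro two_sided_ideal_generated_free relators_carrier)

text \<open>The preimage of the relation ideal under \<open>star\<close> is again an ideal
  containing the relators.\<close>

lemma star_relation_ideal:
  assumes "wf_digraph E" "x \<in> relation_ideal E"
  shows "star x \<in> relation_ideal E"
proof -
  have "relation_ideal E \<subseteq> {x \<in> free_carrier (generators E). star x \<in> relation_ideal E}"
    by (subst relation_ideal_def, rule generated_ideal_subset[OF star_ideal[OF relation_ideal_ideal]])
       (use assms(1) star_relators relators_carrier generated_ideal_superset in
         \<open>fastforce simp: relation_ideal_def\<close>)+
  with assms show ?thesis
    by blast
qed

section \<open>Annihilators of ideals generated by hereditary sets\<close>

text \<open>\<open>J\<close> stands for the preimage of \<open>I(H)\<^sup>\<bottom>\<close> in the
  free algebra; of the elements of \<open>I(H)\<close>, only the ghost paths ending in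
  \<open>H\<close> are used to annihilate it.\<close>

locale hereditary_annihilator = leavitt E R
  for E :: "('v, 'e) pre_digraph" and R :: "(('v, 'e) generator word \<Rightarrow>\<^sub>0 'k::field) set" +
  fixes H :: "'v set" and J :: "(('v, 'e) generator word \<Rightarrow>\<^sub>0 'k) set"
  assumes hereditary: "hereditary E H"
    and ann_carrier: "a \<in> J \<Longrightarrow> a \<in> C"
    and ann_left: "c \<in> C \<Longrightarrow> a \<in> J \<Longrightarrow> c * a \<in> J"
    and ann_right: "c \<in> C \<Longrightarrow> a \<in> J \<Longrightarrow> a * c \<in> J"
    and ann: "awalk u p w \<Longrightarrow> w \<in> H \<Longrightarrow> a \<in> J \<Longrightarrow> ghost_path w p * a \<in> R"
    and vertex_nonzero: "w \<in> H \<Longrightarrow> const k * var (Vertex w) \<in> R \<Longrightarrow> k = 0"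
begin

text \<open>
  Multiply on the right by the longest path \<open>m\<close> of the combination and on the left by the ghost of
  a shortest path \<open>g\<close> from \<open>u\<close> to \<open>H\<close>. For \<open>q \<noteq> m\<close> the product of the ghost of \<open>q\<close> with \<open>m\<close> is
  zero or a nontrivial closed path at \<open>u\<close>; such a path never meets \<open>H\<close> and is not an initial
  segment of \<open>g\<close>, so the ghost of \<open>g\<close> kills it and only the term of \<open>m\<close> survives.
\<close>

lemma ghost_combination_trivial:
  fixes k :: "'e list \<Rightarrow> 'k"
  assumes fin: "finite M" and paths: "\<And>q. q \<in> M \<Longrightarrow> \<exists>u'. awalk u' q u"
    and uH: "u \<notin> H" and reach: "awalk u g w" "w \<in> H"
    and a: "a \<in> J" "a \<approx> (\<Sum>q \<in> M. const (k q) * ghost_path u q)"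
    and "q \<in> M"
  shows "k q = 0"
proof (rule ccontr)
  assume "k q \<noteq> 0"
  define N where "N = {q \<in> M. k q \<noteq> 0}"
  have N: "finite N" "N \<noteq> {}"
    using fin \<open>q \<in> M\<close> \<open>k q \<noteq> 0\<close> by (auto simp: N_def)
  have "Max (length ` N) \<in> length ` N"
    using N by (intro Max_in) auto
  then obtain m where mN: "m \<in> N" and "length m = Max (length ` N)"
    by auto
  then have m_max: "\<And>q. q \<in> N \<Longrightarrow> length q \<le> length m"
    using N by simp
  from mN obtain s where m: "awalk s m u" and km: "k m \<noteq> 0"
    using paths by (auto simp: N_def)
  obtain g w where g: "awalk u g w" and w: "w \<in> H"
    and g_min: "\<And>g' w'. awalk u g' w' \<Longrightarrow> w' \<in> H \<Longrightarrow> length g \<le> length g'"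
  proof -
    let ?P = "\<lambda>n. \<exists>g w. awalk u g w \<and> w \<in> H \<and> length g = n"
    have "?P (LEAST n. ?P n)"
      by (rule LeastI_ex) (use reach in blast)
    then show thesis
      using that Least_le[of ?P] by metis
  qed
  let ?g = "ghost_path w g" and ?m = "real_path u m"
  have gC: "?g \<in> C" and mC: "?m \<in> C"
    using g m path_carrier by blast+
  have closed: "?g * real_path u r \<in> R" if r: "awalk u r u" "r \<noteq> []" for r
  proof (rule ghost_real_orth[OF g r(1)])
    show "\<not> prefix g r"
    proof
      assume "prefix g r"
      then obtain t where "r = g @ t"
        by (auto simp: prefix_def)
      then have "awalk w t u"
        using r g by (metis awalk_append_iff awalk_ends)
      then show False
        using hereditary w uH by (auto simp: hereditary_def)
    qed
    show "\<not> prefix r g"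
    proof
      assume "prefix r g"
      then obtain t where t: "g = r @ t"
        by (auto simp: prefix_def)
      then have "awalk u t w"
        using r g by (metis awalk_append_iff awalk_ends)
      then show False
        using g_min[of t w] w t r by simp
    qed
  qed
  have other: "ghost_path u q * ?m \<in> R \<or> (\<exists>r. awalk u r u \<and> r \<noteq> [] \<and> ghost_path u q * ?m \<approx> real_path u r)"
    if q: "q \<in> N" "q \<noteq> m" for q
  proof -
    obtain s' where q': "awalk s' q u"
      using q paths by (auto simp: N_def)
    show ?thesis
    proof (cases "prefix q m")
      case True
      then obtain r where r: "m = q @ r"
        by (auto simp: prefix_def)
      show ?thesis
      proof (cases "awalk u r u")
        case True
        then show ?thesis
          using ghost_real_append[OF q' True] r q by auto
      next
        case False
        \<comment> \<open>A nonempty \<open>q\<close> would determine its end vertex, forcing the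
          rest \<open>r\<close> to be a closed walk at \<open>u\<close>. So \<open>q\<close> is the
          vertex \<open>u\<close>, while \<open>m\<close> starts elsewhere.\<close>
        then have "q = []"
          using m q' r by (metis awalk_append_iff awalk_ends)
        then have "u \<noteq> s"
          using False m r by auto
        then show ?thesis
          using vertex_real_path_orth[OF m, of u] m \<open>q = []\<close> by auto
      qed
    next
      case False
      then have "\<not> prefix m q"
        using m_max[OF q(1)] by (auto simp: prefix_def)
      then show ?thesis
        using ghost_real_orth[OF q' m False] by simp
    qed
  qed
  have rest: "const (k q) * (?g * (ghost_path u q * ?m)) \<in> R" if "q \<in> M - {m}" for q
  proof (cases "q \<in> N")
    case False
    then show ?thesis
      using that by (simp add: N_def)
  next
    case True
    with other[of q] that have "?g * (ghost_path u q * ?m) \<in> R"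
      using closed cong_left[OF gC] cong_mem ideal_left[OF gC] by blast
    then show ?thesis
      by (rule ideal_const)
  qed
  have "?g * (a * ?m) \<in> R"
    using g w a mC by (intro ann ann_right)
  moreover have "?g * (a * ?m) \<approx> ?g * ((\<Sum>q \<in> M. const (k q) * ghost_path u q) * ?m)"
    by (intro cong_left cong_right gC mC a)
  ultimately have "?g * ((\<Sum>q \<in> M. const (k q) * ghost_path u q) * ?m) \<in> R"
    by (simp add: cong_mem)
  also have "?g * ((\<Sum>q \<in> M. const (k q) * ghost_path u q) * ?m)
      = (\<Sum>q \<in> M. const (k q) * (?g * (ghost_path u q * ?m)))"
    by (simp add: sum_distrib_left sum_distrib_right mult.assoc const_left_commute)
  also have "\<dots> = const (k m) * (?g * (ghost_path u m * ?m))
      + (\<Sum>q \<in> M - {m}. const (k q) * (?g * (ghost_path u q * ?m)))"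
    using fin mN by (intro sum.remove) (auto simp: N_def)
  finally have "const (k m) * (?g * (ghost_path u m * ?m)) \<in> R"
    using ideal_diff[OF _ ideal_sum[of "M - {m}", OF rest]] by fastforce
  moreover have "?g * (ghost_path u m * ?m) \<approx> ?g"
  proof -
    have "awalk u [] u"
      using g by (auto simp: awalk_Nil_iff)
    then have "?g * (ghost_path u m * ?m) \<approx> ?g * V u"
      using ghost_real_append[OF m, of "[]" u] by (intro cong_left gC) simp
    also have "\<dots> \<approx> ?g"
      by (rule ghost_path_tail[OF g])
    finally show ?thesis .
  qed
  ultimately have "const (k m) * ?g \<in> R"
    using cong_const cong_mem by blast
  \<comment> \<open>Multiplying by the path \<open>g\<close> itself turns its ghost into the vertex
    \<open>w\<close> of \<open>H\<close>, which is nonzero modulo \<open>R\<close>.\<close>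
  then have "const (k m) * ?g * real_path w g \<in> R"
    by (rule ideal_right[OF path_carrier(2)[OF g]])
  moreover have "?g * real_path w g \<approx> V w"
    using ghost_real_append[OF g, of "[]" w] g by (auto simp: awalk_Nil_iff)
  ultimately have "const (k m) * V w \<in> R"
    using cong_const cong_mem by (metis mult.assoc)
  then show False
    using vertex_nonzero[OF w] km by blast
qed

text \<open>
  Expanding \<open>u\<close> as the sum of all \<open>e e\<^sup>*\<close>, the edges into \<open>H\<close> contribute nothing to \<open>u a\<close>,
  so \<open>u a = p p\<^sup>* a\<close> for the path \<open>p\<close> of length \<open>n\<close> that stays in \<open>U\<close>.
\<close>

lemma unroll:
  assumes regular: "U \<subseteq> regular_verts E"
    and step: "\<And>u. u \<in> U \<Longrightarrow> \<exists>e \<in> out_arcs E u. head E e \<in> U \<and> (\<forall>f \<in> out_arcs E u. f \<noteq> e \<longrightarrow> head E f \<in> H)"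
    and "u \<in> U"
  shows "\<exists>p u'. u' \<in> U \<and> length p = n \<and> awalk u p u' \<and>
    (\<forall>a \<in> J. ghost_path u' p * a \<in> R \<longrightarrow> V u * a \<in> R)"
  using \<open>u \<in> U\<close>
proof (induction n arbitrary: u)
  case 0
  then have "awalk u [] u"
    using regular by (auto simp: awalk_Nil_iff regular_verts_def)
  then show ?case
    using 0 by (intro exI[of _ "[]"] exI[of _ u]) auto
next
  case (Suc n)
  obtain e where e: "e \<in> out_arcs E u" "head E e \<in> U"
    and exits: "\<And>f. f \<in> out_arcs E u \<Longrightarrow> f \<noteq> e \<Longrightarrow> head E f \<in> H"
    using step[OF Suc.prems] by blast
  obtain p u' where p: "u' \<in> U" "length p = n" "awalk (head E e) p u'"
    and IH: "\<And>a. a \<in> J \<Longrightarrow> ghost_path u' p * a \<in> R \<Longrightarrow> V (head E e) * a \<in> R"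
    using Suc.IH[OF e(2)] by blast
  have ure: "u \<in> regular_verts E"
    using Suc.prems regular by blast
  have "V u * a \<in> R" if a: "a \<in> J" and h: "ghost_path u' (e # p) * a \<in> R" for a
  proof -
    have Ya: "Y f * a \<in> R" if f: "f \<in> out_arcs E u" for f
    proof (cases "f = e")
      case True
      \<comment> \<open>The induction hypothesis is applied to \<open>Y e * a\<close>, which lies in
        \<open>J\<close> again; this is why it ranges over all of \<open>J\<close>.\<close>
      have "V (head E e) * (Y e * a) \<in> R"
        using h a e by (intro IH ann_left) (simp_all add: mult.assoc)
      moreover have "V (head E e) * Y e * a \<approx> Y e * a"
        using a e by (intro cong_right ann_carrier head_ghost) auto
      ultimately show ?thesis
        using True by (simp add: mult.assoc cong_mem)
    next
      case False
      have "ghost_path (head E f) [f] * a \<in> R"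
        using exits[OF f False] f a by (intro ann[of u]) (auto simp: awalk_Cons_iff awalk_Nil_iff)
      moreover have "V (head E f) * Y f * a \<approx> Y f * a"
        using a f by (intro cong_right ann_carrier head_ghost) auto
      ultimately show ?thesis
        by (simp add: cong_mem)
    qed
    have "V u * a \<approx> (\<Sum>f \<in> out_arcs E u. X f * Y f) * a"
      by (intro cong_right ann_carrier[OF a] vertex_expand ure)
    moreover have "(\<Sum>f \<in> out_arcs E u. X f * Y f) * a = (\<Sum>f \<in> out_arcs E u. X f * (Y f * a))"
      by (simp add: sum_distrib_right mult.assoc)
    moreover have "(\<Sum>f \<in> out_arcs E u. X f * (Y f * a)) \<in> R"
      by (intro ideal_sum ideal_left Ya) auto
    ultimately show ?thesis
      by (simp add: cong_mem)
  qed
  moreover have "awalk u (e # p) u'"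
    using e p by (auto simp: awalk_Cons_iff)
  ultimately show ?case
    using p by (intro exI[of _ "e # p"] exI[of _ u']) auto
qed

text \<open>Unroll along a path \<open>p\<close> at least as long as every word of \<open>a\<close>.
  Then the ghost of \<open>p\<close> times \<open>a\<close> is a combination of ghost paths lying in
  \<open>J\<close>, and all its coefficients vanish.\<close>

lemma vertex_annihilates:
  assumes regular: "U \<subseteq> regular_verts E"
    and step: "\<And>u. u \<in> U \<Longrightarrow> \<exists>e \<in> out_arcs E u. head E e \<in> U \<and> (\<forall>f \<in> out_arcs E u. f \<noteq> e \<longrightarrow> head E f \<in> H)"
    and disj: "U \<inter> H = {}" and reach: "\<And>u. u \<in> U \<Longrightarrow> \<exists>p w. awalk u p w \<and> w \<in> H"
    and "u \<in> U" and a: "a \<in> J"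
  shows "V u * a \<in> R"
proof -
  \<comment> \<open>The inserted 0 covers \<open>a = 0\<close>, which has no words.\<close>
  define n where "n = Max (insert 0 ((\<lambda>w. length (letters w)) ` Poly_Mapping.keys a))"
  have len: "length (letters w) \<le> n" if "w \<in> Poly_Mapping.keys a" for w
    unfolding n_def using that by (intro Max_ge) auto
  obtain p u' where u': "u' \<in> U" and p: "length p = n" "awalk u p u'"
    and imp: "ghost_path u' p * a \<in> R \<Longrightarrow> V u * a \<in> R"
    using unroll[OF regular step \<open>u \<in> U\<close>, of n] a by blast
  obtain M k where M: "finite M" "\<And>q. q \<in> M \<Longrightarrow> \<exists>u''. awalk u'' q u'"
    and eq: "ghost_path u' p * a \<approx> (\<Sum>q \<in> M. const (k q) * ghost_path u' q)"
    using ghost_path_mult_combination[OF p(2) ann_carrier[OF a]] len p(1) by blast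
  have "ghost_path u' p * a \<in> J"
    by (intro ann_left path_carrier[OF p(2)] a)
  moreover obtain g w where "awalk u' g w" "w \<in> H"
    using reach[OF u'] by blast
  ultimately have "k q = 0" if "q \<in> M" for q
    using ghost_combination_trivial[OF M _ _ _ _ eq that] disj u' by blast
  then have "(\<Sum>q \<in> M. const (k q) * ghost_path u' q) \<in> R"
    by (intro ideal_sum) simp
  then show ?thesis
    using imp eq cong_mem by blast
qed

end

section \<open>Cycles in quotient graphs\<close>

lemma (in wf_digraph) cycle_tails:
  assumes p: "awalk b p b" "p \<noteq> []" and e: "e \<in> set p"
  shows "head G e \<in> tail G ` set p" and "\<exists>q. awalk (tail G e) q b" and "\<exists>q. awalk b q (tail G e)"
proof -
  obtain p1 p2 where split: "p = p1 @ e # p2"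
    using e by (meson split_list)
  then have w: "awalk b p1 (tail G e)" "awalk (tail G e) (e # p2) b" "awalk (head G e) p2 b"
    using p(1) by (auto simp: awalk_Cons_iff)
  then show "\<exists>q. awalk (tail G e) q b" "\<exists>q. awalk b q (tail G e)"
    by blast+
  show "head G e \<in> tail G ` set p"
  proof (cases p2)
    case Nil
    then have "head G e = b"
      using w(3) by (simp add: awalk_Nil_iff)
    \<comment> \<open>The last edge wraps around to the first.\<close>
    moreover have "tail G (hd p) = b"
      using p by (cases p) (auto simp: awalk_Cons_iff)
    ultimately show ?thesis
      using p(2) by (metis hd_in_set imageI)
  next
    case (Cons f p3)
    then show ?thesis
      using w(3) split by (auto simp: awalk_Cons_iff)
  qed
qed

lemma cas_quotient_graph: "pre_digraph.cas (quotient_graph E H) = pre_digraph.cas E"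
proof (intro ext)
  fix u p v
  show "pre_digraph.cas (quotient_graph E H) u p v = pre_digraph.cas E u p v"
    by (induction p arbitrary: u) (auto simp: pre_digraph.cas.simps quotient_graph_def)
qed

lemma awalk_quotient_graph:
  "pre_digraph.awalk (quotient_graph E H) u p v \<longleftrightarrow>
    pre_digraph.awalk E u p v \<and> u \<notin> H \<and> (\<forall>e \<in> set p. head E e \<notin> H)"
  by (auto simp: pre_digraph.awalk_def cas_quotient_graph) (auto simp: quotient_graph_def)

text \<open>Every source on a closed walk reaches the base vertex, so heredity keeps all sources
  outside \<open>H\<close> when the base is; conversely, each range on the walk is also a
  source.\<close>

lemma cycle_quotient_graph:
  assumes "wf_digraph E" "hereditary E H"
  shows "pre_digraph.cycle (quotient_graph E H) p \<longleftrightarrow>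
    pre_digraph.cycle E p \<and> tail E ` set p \<inter> H = {}"
proof -
  interpret wf_digraph E by fact
  have "u \<notin> H \<and> (\<forall>e \<in> set p. head E e \<notin> H) \<longleftrightarrow> tail E ` set p \<inter> H = {}"
    if p: "awalk u p u" "p \<noteq> []" for u
  proof
    assume *: "u \<notin> H \<and> (\<forall>e \<in> set p. head E e \<notin> H)"
    have "tail E e \<notin> H" if "e \<in> set p" for e
      using cycle_tails(2)[OF p that] assms(2) * by (auto simp: hereditary_def)
    then show "tail E ` set p \<inter> H = {}"
      by auto
  next
    assume *: "tail E ` set p \<inter> H = {}"
    have "u = tail E (hd p)"
      using p by (cases p) (auto simp: awalk_Cons_iff)
    then show "u \<notin> H \<and> (\<forall>e \<in> set p. head E e \<notin> H)"
      using * cycle_tails(1)[OF p] p(2) by (metis disjoint_iff hd_in_set imageI)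
  qed
  then show ?thesis
    unfolding cycle_iff_distinct_tails awalk_quotient_graph by (auto simp: quotient_graph_def)
qed

text \<open>Every vertex of the cycle reaches \<open>v\<close>, so if \<open>v\<close> is outside
  \<open>H\<close>, the whole cycle is. The quotient has only edges of \<open>E\<close>, hence no
  new exits.\<close>

lemma P_c_subset_quotient:
  assumes "wf_digraph E" "hereditary E H"
  shows "P_c E - H \<subseteq> P_c (quotient_graph E H)"
proof
  interpret wf_digraph E by fact
  fix v assume "v \<in> P_c E - H"
  then obtain p e where p: "cycle p" and no_exit: "\<nexists>f. is_exit E p f"
    and e: "e \<in> set p" "v = tail E e" and vH: "v \<notin> H"
    by (auto simp: P_c_def)
  obtain b where b: "awalk b p b" and "p \<noteq> []"
    using p by (auto simp: cycle_iff_distinct_tails)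
  have "tail E f \<notin> H" if f: "f \<in> set p" for f
  proof
    assume "tail E f \<in> H"
    moreover obtain q1 q2 where "awalk (tail E f) q1 b" "awalk b q2 v"
      using cycle_tails[OF b \<open>p \<noteq> []\<close>] f e by blast
    ultimately show False
      using assms(2) vH unfolding hereditary_def by blast
  qed
  then have "pre_digraph.cycle (quotient_graph E H) p"
    using p assms by (auto simp: cycle_quotient_graph)
  moreover have "\<nexists>f. is_exit (quotient_graph E H) p f"
    using no_exit by (auto simp: is_exit_def quotient_graph_def)
  ultimately show "v \<in> P_c (quotient_graph E H)"
    using e by (auto simp: P_c_def quotient_graph_def)
qed

lemma row_finite_regular:
  "row_finite E \<Longrightarrow> wf_digraph E \<Longrightarrow> e \<in> arcs E \<Longrightarrow> tail E e \<in> regular_verts E"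
  by (auto simp: regular_verts_def row_finite_def wf_digraph_def)

text \<open>The constant function 1 is sent to a function with value \<open>k\<close> at the point
  \<open>(v, 0)\<close>.\<close>

lemma vertex_notin_branch_kernel:
  fixes E :: "('v, 'e) pre_digraph"
  assumes v: "v \<notin> H" and mem: "const k * var (Vertex v) \<in>
    (branch.kernel E H (generators E) :: (('v, 'e) generator word \<Rightarrow>\<^sub>0 'k::field) set)"
  shows "k = 0"
proof -
  have "branch.ev E H (const k * var (Vertex v)) (\<lambda>b. 1) (v, 0) = (0 :: 'k)"
    using mem by (simp add: branch.kernel_def)
  then show ?thesis
    using v by (simp add: branch.ev_const_mult)
qed

section \<open>Surjectivity from the regularity of the ideal\<close>

theorem proposition3p8:
  fixes E :: "('v, 'e) pre_digraph" and H :: "'v set"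
  assumes "wf_digraph E"
    and "countable (verts E)" and "countable (arcs E)"
    and "row_finite E"
    and "saturated E H" and "hereditary E H"
    and "regular_ideal
           (leavitt_path_algebra E :: ('k::field, ('k, 'v, 'e) lpa_elem) k_algebra)
           (vertex_ideal E H)"
  shows "bij_betw (\<lambda>v. v) (P_c E - H) (P_c (quotient_graph E H))"
proof -
  note wf = assms(1) and rf = assms(4) and sat = assms(5) and her = assms(6)
  let ?S = "generators E" and ?R = "relation_ideal E :: (('v, 'e) generator word \<Rightarrow>\<^sub>0 'k) set"
  interpret leavitt E ?R
    by (intro leavitt.intro free_ideal.intro leavitt_axioms.intro wf relation_ideal_ideal)
       (simp add: relation_ideal_def generated_ideal_superset)
  have L: "L = leavitt_path_algebra E"
    by (simp add: leavitt_path_algebra_def)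
  have I_gen: "vertex_ideal E H = generated_ideal L (cls ` V ` H)"
    by (simp add: vertex_ideal_def L lpa_vertex_def image_image)
  have I_ideal: "two_sided_ideal L (vertex_ideal E H)"
    and I_perp: "vertex_ideal E H = perp L (perp L (vertex_ideal E H))"
    using assms(7) by (simp_all add: regular_ideal_def L)
  have R_kernel: "?R \<subseteq> branch.kernel E H' ?S" if "saturated E H'" "hereditary E H'" for H'
    unfolding relation_ideal_def
    by (intro generated_ideal_subset branch.kernel_ideal relators_kernel wf rf that)
  have HV: "H \<subseteq> verts E"
    using her by (simp add: hereditary_def)
  define I where "I = pullback (vertex_ideal E H)"
  have I: "two_sided_ideal (free_algebra ?S) I"
    unfolding I_def by (rule pullback_ideal[OF I_ideal])
  have R_I: "?R \<subseteq> I"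
  proof
    fix x assume x: "x \<in> ?R"
    then have "cls x = cls 0"
      by (simp add: cls_eq)
    then show "x \<in> I"
      using x I_ideal ideal_carrier[OF x] by (simp add: I_def pullback_def two_sided_ideal_def quotient_zero)
  qed
  have V_I: "V w \<in> I" if "w \<in> H" for w
    using that HV generated_ideal_superset[of "cls ` V ` H" L] by (auto simp: I_def pullback_def I_gen)
  have I_sub: "I \<subseteq> K" if "two_sided_ideal (free_algebra ?S) K" "?R \<subseteq> K" "V ` H \<subseteq> K" for K
    unfolding I_def I_gen by (rule pullback_generated_subset[OF that])
  have star_I: "star x \<in> I" if "x \<in> I" for x
  proof -
    have "I \<subseteq> {x \<in> C. star x \<in> I}"
    proof (rule I_sub[OF star_ideal[OF I]])
      show "?R \<subseteq> {x \<in> C. star x \<in> I}"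
        using star_relation_ideal[OF wf] R_I ideal_carrier by blast
      show "V ` H \<subseteq> {x \<in> C. star x \<in> I}"
        using V_I HV by auto
    qed
    with that show ?thesis
      by blast
  qed
  \<comment> \<open>The preimage of \<open>I(H)\<^sup>\<bottom>\<close>, written with
    representatives.\<close>
  define J where "J = {a \<in> C. \<forall>y \<in> I. a * y \<in> ?R \<and> y * a \<in> ?R}"
  have I_mult: "c \<in> C \<Longrightarrow> y \<in> I \<Longrightarrow> c * y \<in> I \<and> y * c \<in> I" for c y
    using I by (auto simp: two_sided_ideal_free_algebra)
  have star_J: "star a \<in> J" if a: "a \<in> J" for a
  proof -
    have "star a * y \<in> ?R \<and> y * star a \<in> ?R" if "y \<in> I" for y
    proof -
      have "star y * a \<in> ?R" "a * star y \<in> ?R"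
        using star_I[OF that] a by (auto simp: J_def)
      then have "star (star y * a) \<in> ?R" "star (a * star y) \<in> ?R"
        by (blast intro: star_relation_ideal[OF wf])+
      then show ?thesis
        by simp
    qed
    with a show ?thesis
      by (simp add: J_def)
  qed
  have ghost_I: "ghost_path w p \<in> I" if "awalk u p w" "w \<in> H" for u p w
    using that
  proof (induction p arbitrary: u)
    case (Cons e p)
    then show ?case
      using I_mult by (auto simp: awalk_Cons_iff)
  qed (simp add: V_I)
  interpret hereditary_annihilator E ?R H J
  proof
    show "hereditary E H"
      by (rule her)
    show "a \<in> C" if "a \<in> J" for a
      using that by (simp add: J_def)
    show "c * a \<in> J" if c: "c \<in> C" and a: "a \<in> J" for c a
    proof -
      have "c * (a * y) \<in> ?R \<and> y * c * a \<in> ?R" if "y \<in> I" for y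
        using a ideal_left[OF c] I_mult[OF c that] that by (simp add: J_def)
      with a c show ?thesis
        by (auto simp: J_def mult.assoc)
    qed
    show "a * c \<in> J" if c: "c \<in> C" and a: "a \<in> J" for c a
    proof -
      have "a * (c * y) \<in> ?R \<and> y * a * c \<in> ?R" if "y \<in> I" for y
        using a ideal_right[OF c] I_mult[OF c that] that by (simp add: J_def)
      with a c show ?thesis
        by (auto simp: J_def mult.assoc)
    qed
    show "ghost_path w p * a \<in> ?R" if "awalk u p w" "w \<in> H" "a \<in> J" for u p w a
      using ghost_I[OF that(1,2)] that(3) by (auto simp: J_def)
    \<comment> \<open>With the empty set in place of \<open>H\<close>, the representation kills no
      vertex, so the vertices in \<open>H\<close> are nonzero in the Leavitt path algebra.\<close>
    have "saturated E {}" "hereditary E {}"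
      by (auto simp: saturated_def hereditary_def regular_verts_def)
    then show "k = 0" if "w \<in> H" "const k * var (Vertex w) \<in> ?R" for w k
      using vertex_notin_branch_kernel[of w "{}" k E] R_kernel[of "{}"] that(2) by blast
  qed
  have "v \<in> P_c E - H" if v: "v \<in> P_c (quotient_graph E H)" for v
  proof -
    let ?Q = "quotient_graph E H"
    obtain p e0 where Qp: "pre_digraph.cycle ?Q p" and no_exit: "\<nexists>f. is_exit ?Q p f"
      and e0: "e0 \<in> set p" "v = tail E e0"
      using v by (auto simp: P_c_def quotient_graph_def)
    then have p: "cycle p" and disj: "tail E ` set p \<inter> H = {}"
      by (auto simp: cycle_quotient_graph[OF wf her])
    then obtain b where b: "awalk b p b" "p \<noteq> []"
      by (auto simp: cycle_iff_distinct_tails)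
    \<comment> \<open>An edge is lost in the quotient exactly when its range lies in
      \<open>H\<close>.\<close>
    have exit_H: "head E f \<in> H" if "is_exit E p f" for f
      using no_exit that by (fastforce simp: is_exit_def quotient_graph_def)
    have vH: "v \<notin> H"
      using disj e0 by auto
    have "\<nexists>f. is_exit E p f"
    proof
      assume "\<exists>f. is_exit E p f"
      then obtain f where f: "is_exit E p f"
        by blast
      then obtain e' where fe: "f \<in> arcs E" "e' \<in> set p" "tail E f = tail E e'"
        unfolding is_exit_def using nth_mem by blast
      have p_arcs: "set p \<subseteq> arcs E"
        using b by auto
      let ?U = "tail E ` set p"
      have "V u * a \<in> ?R" if u: "u \<in> ?U" and a: "a \<in> J" for u a
      proof (rule vertex_annihilates[OF _ _ disj _ u a])
        show "?U \<subseteq> regular_verts E"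
          using p_arcs row_finite_regular[OF rf wf] by blast
      next
        fix u assume "u \<in> ?U"
        then obtain e where e: "e \<in> set p" "u = tail E e"
          by blast
        have "head E f \<in> H" if "f \<in> out_arcs E u" "f \<noteq> e" for f
          using that e exit_H[of f] by (auto simp: is_exit_def in_set_conv_nth)
        then show "\<exists>e \<in> out_arcs E u. head E e \<in> ?U \<and> (\<forall>f \<in> out_arcs E u. f \<noteq> e \<longrightarrow> head E f \<in> H)"
          using e p_arcs cycle_tails(1)[OF b e(1)] by (intro bexI[of _ e]) auto
      next
        \<comment> \<open>Follow the cycle to its base and on to the source of the exit
          \<open>f\<close>, then leave through \<open>f\<close> into \<open>H\<close>.\<close>
        fix u assume "u \<in> ?U"
        then obtain q1 q2 where "awalk u q1 b" "awalk b q2 (tail E f)"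
          using cycle_tails[OF b] fe by (metis imageE)
        moreover have "awalk (tail E f) [f] (head E f)"
          using fe(1) by (simp add: awalk_Cons_iff awalk_Nil_iff)
        ultimately have "awalk u (q1 @ q2 @ [f]) (head E f)"
          by (meson awalk_appendI)
        then show "\<exists>p w. awalk u p w \<and> w \<in> H"
          using exit_H[OF f] by blast
      qed
      then have va: "V v * a \<in> ?R" if "a \<in> J" for a
        using e0 that by blast
      \<comment> \<open>The involution preserves \<open>J\<close> and fixes \<open>V v\<close>, so
        it carries the left-hand statement for \<open>star a\<close> to the right-hand one for
        \<open>a\<close>.\<close>
      have av: "a * V v \<in> ?R" if "a \<in> J" for a
        using star_relation_ideal[OF wf va[OF star_J[OF that]]] by simp
      have vC: "V v \<in> C"
        using e0 p_arcs by auto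
      have "cls (V v) \<in> perp L (perp L (vertex_ideal E H))"
      proof (rule mem_perp_perp[OF _ vC])
        show "vertex_ideal E H \<subseteq> alg_carrier L"
          using I_ideal by (simp add: two_sided_ideal_def)
        show "V v * a \<in> ?R \<and> a * V v \<in> ?R"
          if "a \<in> C" "\<forall>y \<in> pullback (vertex_ideal E H). a * y \<in> ?R \<and> y * a \<in> ?R" for a
          using that va av by (simp add: J_def I_def)
      qed
      then have "V v \<in> I"
        using vC I_perp by (simp add: I_def pullback_def)
      \<comment> \<open>Now the representation is taken for \<open>H\<close> itself: all of
        \<open>I\<close> acts as zero, whereas \<open>V v\<close> does not.\<close>
      moreover have "V ` H \<subseteq> branch.kernel E H ?S"
        using HV by (auto simp: branch.kernel_def fun_eq_iff)
      ultimately have "V v \<in> branch.kernel E H ?S"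
        using I_sub[OF branch.kernel_ideal R_kernel[OF sat her]] by blast
      then show False
        using vertex_notin_branch_kernel[OF vH, of 1 E] by simp
    qed
    then show ?thesis
      using p e0 vH by (auto simp: P_c_def)
  qed
  then have "P_c E - H = P_c (quotient_graph E H)"
    using P_c_subset_quotient[OF wf her] by blast
  then show ?thesis
    by (simp add: bij_betw_def)
qed


end
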